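(* Let $d\ge 2$, let $R\subset X^d$ be a region not containing $\mathbf 0$, let $b\in\Omega$ be a height function, and let $w:E^d(R)\to(0,\infty)$ be a weight function. Let $\mathbb P_w$ be the Boltzmann measure on $\Omega(R,b)$ with weight $w$. Let $(f_1,f_2)$ be a pair of random height functions with law $\mathbb P_w\times\mathbb P_w$ (also denoted $\mathbb P_w$, with expectation $\mathbb E_w$), let $g:=f_1-f_2$, and write $f$ for $f_1$. Then for any $\mathbf x\in X^d$, \[\operatorname{Var}_w f(\mathbf x)=\tfrac12(d+1)^2\,\mathbb E_w\, d_{\operatorname{LSD}(g)}(\mathbf 0,\mathbf x).\] In other words, the variance of $f(\mathbf x)$ equals $\frac12(d+1)^2$ times the expectation of the number of $g$-boundaries that separate $\mathbf x$ from $\mathbf 0$.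
   Context: Fix an integer $d\ge 2$. Let $\mathbf e_1,\dots,\mathbf e_{d+1}$ be the standard basis of $\mathbb R^{d+1}$, $\mathbf n=\mathbf e_1+\dots+\mathbf e_{d+1}$, $H=\mathbf n^\perp\subset\mathbb R^{d+1}$, $P$ the orthogonal projection onto $H$, and $\mathbf g_i=P\mathbf e_i=\mathbf e_i-\mathbf n/(d+1)$. The simplicial lattice $(X^d,E^d)$ is the graph with vertex set $X^d=P(\mathbb Z^{d+1})\subset H$ (equivalently $\mathbb Z^{d+1}/\mathbb Z\mathbf n$) and edges $\{\mathbf x,\mathbf x+\mathbf g_i\}$, $\mathbf x\in X^d$, $1\le i\le d+1$. A height function is a function $f:X^d\to\mathbb Z$ with $f(\mathbf 0)\in(d+1)\mathbb Z$ and $f(\mathbf x+\mathbf g_i)-f(\mathbf x)\in\{1,-d\}$ for all $\mathbf x\in X^d$ and $i$. $\Omega$ is the set of height functions. For $f\in\Omega$, $T(f):=\{\{\mathbf x,\mathbf x+\mathbf g_i\}\in E^d: f(\mathbf x+\mathbf g_i)-f(\mathbf x)=-d\}$. A simplicial loop is a closed path $(\mathbf s_k)_{0\le k\le d+1}$ in $X^d$ with $\mathbf s_k=\mathbf s_{k-1}+\mathbf g_{\xi(k)}$ for some permutation $\xi$ of $\{1,\dots,d+1\}$. A region is a finite set $R\subset X^d$ whose complement $R^{\mathsf c}=X^d\smallsetminus R$ is connected in $(X^d,E^d)$. $E^d(R)$ is the set of edges incident to at least one vertex of $R$. $\Omega(R,b):=\{f\in\Omega: f|_{R^{\mathsf c}}=b|_{R^{\mathsf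 c}}\}$, a finite set. The Boltzmann measure with weight $w$ is the probability measure $\mathbb P_w$ on $\Omega(R,b)$ with $\mathbb P_w(f)\propto\prod_{e\in T(f)\cap E^d(R)}w(e)$. For $f_1,f_2\in\Omega$ and $g=f_1-f_2$ put $V_g:=\{e\in E^d: g\text{ is not constant on }e\}$ (the symmetric difference of $T(f_1)$ and $T(f_2)$). The boundary graph $G_g$ has vertex set $V_g$, and two elements of $V_g$ are adjacent if some simplicial loop traverses both. A $g$-boundary is a connected component of $G_g$, considered as a subset of $E^d$. A $g$-level set is a connected component of the graph $(X^d,E^d\smallsetminus V_g)$, considered as a subset of $X^d$. For $e\in V_g$, $\mathbf x_g^-(e)$ and $\mathbf x_g^+(e)$ are the endpoints of $e$ at which $g$ takes the smaller, respectively larger, value; $\mathbf x_g^\pm(E)=\{\mathbf x_g^\pm(e):e\in E\}$. $\operatorname{LSD}(g)$ is the graph whose vertices are the $g$-level sets and whose edges are the $g$-boundaries, where a $g$-boundary $E$ connects the $g$-level set containing $\mathbf x_g^-(E)$ to the one containing $\mathbf x_g^+(E)$ (it is known that this is well-defined and a tree). $d_{\operatorname{LSD}(g)}(\mathbf x,\mathbf y)$ is the graph distance in $\operatorname{LSD}(g)$ between the $g$-level sets containing $\mathbf x$ and $\mathbf y$. A $g$-boundary $E$ separates $\mathbf x$ from $\mathbf 0$ if $\mathbf x$ and $\mathbf 0$ lie in different connected components of $(X^d,E^d\smallsetminus E)$. *)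

theory Defs
  imports "HOL-Probability.Probability"
begin

section \<open>Graphs\<close>

(* A simple graph is given by a vertex set V and a set E of unordered pairs {u, v}; edges of E
   with an endpoint outside V are ignored, so (V, E) may be used for the subgraph induced by V. *)

definition linked :: "'v set \<Rightarrow> 'v set set \<Rightarrow> ('v \<times> 'v) set" where
  "linked V E = {(u, v). u \<in> V \<and> v \<in> V \<and> {u, v} \<in> E}\<^sup>*"

definition component_of :: "'v set \<Rightarrow> 'v set set \<Rightarrow> 'v \<Rightarrow> 'v set" where
  "component_of V E u = {v \<in> V. (u, v) \<in> linked V E}"

definition components_of :: "'v set \<Rightarrow> 'v set set \<Rightarrow> 'v set set" where
  "components_of V E = component_of V E ` V"

definition graph_connected :: "'v set \<Rightarrow> 'v set set \<Rightarrow> bool" where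
  "graph_connected V E \<longleftrightarrow> (\<forall>u\<in>V. \<forall>v\<in>V. (u, v) \<in> linked V E)"

(* Graphs whose edges are objects in their own right; mends e is the set of endpoints of e. *)
record ('v, 'e) multigraph =
  mverts :: "'v set"
  medges :: "'e set"
  mends :: "'e \<Rightarrow> 'v set"

definition madj :: "('v, 'e) multigraph \<Rightarrow> ('v \<times> 'v) set" where
  "madj G = {(u, v). u \<in> mverts G \<and> v \<in> mverts G \<and> (\<exists>e\<in>medges G. mends G e = {u, v})}"

(* The length of a shortest walk; unspecified if u and v are not joined by a walk. *)
definition graph_dist :: "('v, 'e) multigraph \<Rightarrow> 'v \<Rightarrow> 'v \<Rightarrow> nat" where
  "graph_dist G u v = (LEAST n. (u, v) \<in> madj G ^^ n)"


section \<open>The simplicial lattice\<close>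

(* Throughout, the dimension d is CARD('n) - 1, so that real ^ 'n is (d+1)-dimensional. *)

definition nvec :: "real ^ 'n" where
  "nvec = (\<Sum>i\<in>UNIV. axis i 1)"

definition hyperplane_H :: "(real ^ 'n) set" where
  "hyperplane_H = {x. x \<bullet> (nvec :: real ^ 'n) = 0}"

definition proj_H :: "real ^ 'n \<Rightarrow> real ^ 'n" where
  "proj_H x = x - ((x \<bullet> nvec) / ((nvec :: real ^ 'n) \<bullet> nvec)) *\<^sub>R nvec"

definition gvec :: "'n \<Rightarrow> real ^ 'n" where
  "gvec i = proj_H (axis i 1)"

definition lattice_verts :: "(real ^ 'n) set" where
  "lattice_verts = proj_H ` {z. \<forall>i. z $ i \<in> \<int>}"

definition lattice_edges :: "(real ^ 'n) set set" where
  "lattice_edges = {{x, x + gvec i} | x i. x \<in> lattice_verts}"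

definition simplicial_loop :: "(nat \<Rightarrow> real ^ 'n) \<Rightarrow> bool" where
  "simplicial_loop s \<longleftrightarrow> s 0 \<in> lattice_verts \<and> s CARD('n) = s 0 \<and>
     (\<exists>\<xi>. bij_betw \<xi> {1..CARD('n)} UNIV \<and>
          (\<forall>k\<in>{1..CARD('n)}. s k = s (k - 1) + gvec (\<xi> k)))"

definition traverses :: "(nat \<Rightarrow> real ^ 'n) \<Rightarrow> (real ^ 'n) set \<Rightarrow> bool" where
  "traverses s e \<longleftrightarrow> (\<exists>k\<in>{1..CARD('n)}. e = {s (k - 1), s k})"


section \<open>Height functions\<close>

(* Functions on the vertex set are represented by functions that are undefined elsewhere, so that
   equality in \<Omega> is equality on the lattice. The increment -d is 1 - CARD('n). *)
definition height_functions :: "(real ^ 'n \<Rightarrow> int) set" where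
  "height_functions = {f \<in> extensional lattice_verts.
     int CARD('n) dvd f 0 \<and>
     (\<forall>x\<in>lattice_verts. \<forall>i. f (x + gvec i) - f x \<in> {1, 1 - int CARD('n)})}"

definition tiling :: "(real ^ 'n \<Rightarrow> int) \<Rightarrow> (real ^ 'n) set set" where
  "tiling f = {{x, x + gvec i} | x i. x \<in> lattice_verts \<and> f (x + gvec i) - f x = 1 - int CARD('n)}"

definition region :: "(real ^ 'n) set \<Rightarrow> bool" where
  "region R \<longleftrightarrow> R \<subseteq> lattice_verts \<and> finite R \<and> graph_connected (lattice_verts - R) lattice_edges"

definition incident_edges :: "(real ^ 'n) set \<Rightarrow> (real ^ 'n) set set" where
  "incident_edges R = {e \<in> lattice_edges. e \<inter> R \<noteq> {}}"

definition Omega :: "(real ^ 'n) set \<Rightarrow> (real ^ 'n \<Rightarrow> int) \<Rightarrow> (real ^ 'n \<Rightarrow> int) set" where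
  "Omega R b = {f \<in> height_functions. \<forall>x\<in>lattice_verts - R. f x = b x}"


section \<open>The Boltzmann measure\<close>

definition boltzmann_weight ::
  "(real ^ 'n) set \<Rightarrow> ((real ^ 'n) set \<Rightarrow> real) \<Rightarrow> (real ^ 'n \<Rightarrow> int) \<Rightarrow> real" where
  "boltzmann_weight R w f = (\<Prod>e\<in>tiling f \<inter> incident_edges R. w e)"

(* embed_pmf is meaningful because the masses are nonnegative with sum 1; see pmf_boltzmann. *)
definition boltzmann ::
  "(real ^ 'n) set \<Rightarrow> (real ^ 'n \<Rightarrow> int) \<Rightarrow> ((real ^ 'n) set \<Rightarrow> real) \<Rightarrow> (real ^ 'n \<Rightarrow> int) pmf" where
  "boltzmann R b w = embed_pmf (\<lambda>f. if f \<in> Omega R b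
     then boltzmann_weight R w f / (\<Sum>h\<in>Omega R b. boltzmann_weight R w h) else 0)"

(* The joint law of two independent samples f1, f2. *)
definition boltzmann_pair ::
  "(real ^ 'n) set \<Rightarrow> (real ^ 'n \<Rightarrow> int) \<Rightarrow> ((real ^ 'n) set \<Rightarrow> real) \<Rightarrow>
   ((real ^ 'n \<Rightarrow> int) \<times> (real ^ 'n \<Rightarrow> int)) pmf" where
  "boltzmann_pair R b w = pair_pmf (boltzmann R b w) (boltzmann R b w)"


section \<open>Boundaries, level sets and the level set decomposition\<close>

(* Below, g is a difference of two height functions. *)
definition Vset :: "(real ^ 'n \<Rightarrow> int) \<Rightarrow> (real ^ 'n) set set" where
  "Vset g = {e \<in> lattice_edges. \<not> g constant_on e}"

definition boundary_graph_edges :: "(real ^ 'n \<Rightarrow> int) \<Rightarrow> (real ^ 'n) set set set" where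
  "boundary_graph_edges g = {{e, e'} | e e'. e \<in> Vset g \<and> e' \<in> Vset g \<and> e \<noteq> e' \<and>
     (\<exists>s. simplicial_loop s \<and> traverses s e \<and> traverses s e')}"

definition boundaries :: "(real ^ 'n \<Rightarrow> int) \<Rightarrow> (real ^ 'n) set set set" where
  "boundaries g = components_of (Vset g) (boundary_graph_edges g)"

definition level_set_of :: "(real ^ 'n \<Rightarrow> int) \<Rightarrow> real ^ 'n \<Rightarrow> (real ^ 'n) set" where
  "level_set_of g = component_of lattice_verts (lattice_edges - Vset g)"

definition level_sets :: "(real ^ 'n \<Rightarrow> int) \<Rightarrow> (real ^ 'n) set set" where
  "level_sets g = components_of lattice_verts (lattice_edges - Vset g)"

(* For e in Vset g the minimiser and the maximiser of g on the two-element set e are unique. *)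
definition xminus :: "(real ^ 'n \<Rightarrow> int) \<Rightarrow> (real ^ 'n) set \<Rightarrow> real ^ 'n" where
  "xminus g e = arg_min_on g e"

definition xplus :: "(real ^ 'n \<Rightarrow> int) \<Rightarrow> (real ^ 'n) set \<Rightarrow> real ^ 'n" where
  "xplus g e = arg_max_on g e"

(* A boundary E joins the level set containing xminus g ` E to the one containing xplus g ` E. *)
definition LSD :: "(real ^ 'n \<Rightarrow> int) \<Rightarrow> ((real ^ 'n) set, (real ^ 'n) set set) multigraph" where
  "LSD g = \<lparr> mverts = level_sets g, medges = boundaries g,
     mends = (\<lambda>E. {A \<in> level_sets g. xminus g ` E \<subseteq> A \<or> xplus g ` E \<subseteq> A}) \<rparr>"

definition LSD_dist :: "(real ^ 'n \<Rightarrow> int) \<Rightarrow> real ^ 'n \<Rightarrow> real ^ 'n \<Rightarrow> nat" where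
  "LSD_dist g x y = graph_dist (LSD g) (level_set_of g x) (level_set_of g y)"

definition separates :: "(real ^ 'n) set set \<Rightarrow> real ^ 'n \<Rightarrow> real ^ 'n \<Rightarrow> bool" where
  "separates E x y \<longleftrightarrow>
     component_of lattice_verts (lattice_edges - E) x \<noteq> component_of lattice_verts (lattice_edges - E) y"


section \<open>Basic properties; the Boltzmann measure is well defined\<close>

lemma nvec_nth [simp]: "nvec $ i = 1"
  by (simp add: nvec_def axis_def if_distrib cong: if_cong)

lemma nvec_inner_nvec: "(nvec :: real ^ 'n) \<bullet> nvec = real CARD('n)"
  by (simp add: inner_vec_def)

lemma proj_H_in_H: "proj_H x \<in> hyperplane_H"
  by (simp add: proj_H_def hyperplane_H_def inner_diff_left nvec_inner_nvec)

lemma proj_H_orthogonal: "y \<in> hyperplane_H \<Longrightarrow> (x - proj_H x) \<bullet> y = 0"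
  by (simp add: proj_H_def hyperplane_H_def inner_commute)

lemma gvec_eq: "gvec i = axis i 1 - (1 / real CARD('n)) *\<^sub>R (nvec :: real ^ 'n)"
  by (simp add: gvec_def proj_H_def nvec_inner_nvec inner_axis')

lemma linear_proj_H: "linear proj_H"
  by (rule linearI) (simp_all add: proj_H_def algebra_simps inner_add_left add_divide_distrib)

lemma lattice_verts_add_gvec:
  assumes "x \<in> lattice_verts"
  shows "x + gvec i \<in> lattice_verts" "x - gvec i \<in> lattice_verts"
proof -
  obtain z where z: "x = proj_H z" "\<And>i. z $ i \<in> \<int>"
    using assms by (auto simp: lattice_verts_def)
  have "x + gvec i = proj_H (z + axis i 1)" "x - gvec i = proj_H (z - axis i 1)"
    by (simp_all add: z gvec_def linear_add[OF linear_proj_H] linear_diff[OF linear_proj_H])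
  moreover have "(z + axis i 1) $ j \<in> \<int>" "(z - axis i 1) $ j \<in> \<int>" for j
    using z(2) by (auto simp: axis_def)
  ultimately show "x + gvec i \<in> lattice_verts" "x - gvec i \<in> lattice_verts"
    unfolding lattice_verts_def by blast+
qed

lemma height_increment:
  assumes "f \<in> height_functions" "x \<in> lattice_verts"
  shows "\<bar>f (x + gvec i) - f (x :: real ^ 'n)\<bar> \<le> int CARD('n)"
proof -
  have "f (x + gvec i) - f x \<in> {1, 1 - int CARD('n)}"
    using assms unfolding height_functions_def by blast
  moreover have "int CARD('n) \<ge> 1"
    using zero_less_card_finite[where 'a = 'n] by linarith
  ultimately show ?thesis by auto
qed

lemma height_bounded:
  fixes x :: "real ^ 'n"
  assumes "x \<in> lattice_verts"
  shows "\<exists>K. \<forall>f\<in>height_functions. \<bar>f x - f 0\<bar> \<le> K"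
proof -
  define S :: "(real ^ 'n) set" where
    "S = {x \<in> lattice_verts. \<exists>K. \<forall>f\<in>height_functions. \<bar>f x - f 0\<bar> \<le> K}"
  have step: "x + gvec i \<in> S \<and> x - gvec i \<in> S" if xS: "x \<in> S" for x and i :: 'n
  proof -
    obtain K where x: "x \<in> lattice_verts"
      and K: "\<And>f. f \<in> height_functions \<Longrightarrow> \<bar>f x - f 0\<bar> \<le> K"
      using xS by (auto simp: S_def)
    have "\<bar>f (x + gvec i) - f x\<bar> \<le> int CARD('n)" if "f \<in> height_functions" for f
      using that x by (rule height_increment)
    then have "\<forall>f\<in>height_functions. \<bar>f (x + gvec i) - f 0\<bar> \<le> K + int CARD('n)"
      using K by (smt (verit))
    moreover have "\<bar>f x - f (x - gvec i)\<bar> \<le> int CARD('n)" if "f \<in> height_functions" for f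
      using height_increment[OF that lattice_verts_add_gvec(2)[OF x], of i i] by simp
    then have "\<forall>f\<in>height_functions. \<bar>f (x - gvec i) - f 0\<bar> \<le> K + int CARD('n)"
      using K by (smt (verit))
    ultimately show ?thesis
      using lattice_verts_add_gvec[OF x] by (auto simp: S_def)
  qed
  have zero: "0 \<in> S"
    by (auto simp: S_def lattice_verts_def linear_0[OF linear_proj_H] intro!: image_eqI[of _ _ 0])
  have mult: "x + of_int k *\<^sub>R gvec i \<in> S" if "x \<in> S" for x k and i :: 'n
  proof (induction k rule: int_induct[of _ 0])
    case base
    then show ?case using that by simp
  next
    case (step1 k)
    then show ?case using step[of "x + of_int k *\<^sub>R gvec i" i] by (simp add: algebra_simps)
  next
    case (step2 k)
    then show ?case using step[of "x + of_int k *\<^sub>R gvec i" i] by (simp add: algebra_simps)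
  qed
  have sum: "(\<Sum>i\<in>F. of_int (k i) *\<^sub>R gvec i) \<in> S" if "finite F" for F :: "'n set" and k
    using that
  proof (induction F rule: finite_induct)
    case (insert i F)
    then show ?case using mult[OF insert.IH, of "k i" i] by (simp add: add.commute)
  qed (simp add: zero)
  obtain z where z: "x = proj_H z" "\<And>i. z $ i \<in> \<int>"
    using assms by (auto simp: lattice_verts_def)
  have "x = proj_H (\<Sum>i\<in>UNIV. (z $ i) *\<^sub>R axis i 1)"
    by (simp add: z(1) basis_expansion scalar_mult_eq_scaleR[symmetric])
  also have "\<dots> = (\<Sum>i\<in>UNIV. of_int \<lfloor>z $ i\<rfloor> *\<^sub>R gvec i)"
    using z(2) by (simp add: linear_sum[OF linear_proj_H] linear_cmul[OF linear_proj_H] gvec_def)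
  finally have "x \<in> S"
    using sum[of UNIV "\<lambda>i. \<lfloor>z $ i\<rfloor>"] by simp
  then show ?thesis by (simp add: S_def)
qed

lemma finite_Omega:
  fixes R :: "(real ^ 'n) set"
  assumes "region R" "0 \<notin> R"
  shows "finite (Omega R b)"
proof -
  have R: "R \<subseteq> lattice_verts" "finite R"
    using assms(1) by (auto simp: region_def)
  have zero: "(0 :: real ^ 'n) \<in> lattice_verts"
    by (auto simp: lattice_verts_def linear_0[OF linear_proj_H] intro!: image_eqI[of _ _ 0])
  have "\<forall>x\<in>R. \<exists>K. \<forall>f\<in>height_functions. \<bar>f x - f 0\<bar> \<le> K"
    using height_bounded R(1) by blast
  then obtain K where K: "\<And>x f. x \<in> R \<Longrightarrow> f \<in> height_functions \<Longrightarrow> \<bar>f x - f 0\<bar> \<le> K x"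
    by metis
  have "inj_on (\<lambda>f. restrict f R) (Omega R b)"
  proof (rule inj_onI, rule ext)
    fix f f' x assume *: "f \<in> Omega R b" "f' \<in> Omega R b" "restrict f R = restrict f' R"
    then consider "x \<in> R" | "x \<in> lattice_verts - R" | "x \<notin> lattice_verts"
      by blast
    then show "f x = f' x"
    proof cases
      case 1
      then show ?thesis using *(3) by (metis restrict_apply')
    next
      case 2
      then show ?thesis using *(1,2) by (simp add: Omega_def)
    next
      case 3
      then show ?thesis using *(1,2) by (simp add: Omega_def height_functions_def extensional_def)
    qed
  qed
  moreover have "(\<lambda>f. restrict f R) ` Omega R b \<subseteq> (\<Pi>\<^sub>E x\<in>R. {b 0 - K x..b 0 + K x})"
  proof (intro image_subsetI restrict_PiE_iff[THEN iffD2] ballI)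
    fix f x assume f: "f \<in> Omega R b" and x: "x \<in> R"
    then have "f \<in> height_functions" "f 0 = b 0"
      using zero assms(2) by (auto simp: Omega_def)
    then show "f x \<in> {b 0 - K x..b 0 + K x}"
      using K[OF x, of f] by auto
  qed
  then have "finite ((\<lambda>f. restrict f R) ` Omega R b)"
    by (rule finite_subset) (simp add: finite_PiE R(2))
  ultimately show ?thesis
    using finite_imageD by blast
qed

lemma pmf_boltzmann:
  assumes "region R" "0 \<notin> R" "b \<in> height_functions"
    and w: "\<And>e. e \<in> incident_edges R \<Longrightarrow> w e > 0"
  shows "pmf (boltzmann R b w) f = (if f \<in> Omega R b
     then boltzmann_weight R w f / (\<Sum>h\<in>Omega R b. boltzmann_weight R w h) else 0)"
proof -
  let ?Z = "\<Sum>h\<in>Omega R b. boltzmann_weight R w h"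
  let ?p = "\<lambda>f. if f \<in> Omega R b then boltzmann_weight R w f / ?Z else 0"
  have fin: "finite (Omega R b)"
    using assms(1,2) by (rule finite_Omega)
  have pos: "boltzmann_weight R w h > 0" for h
    unfolding boltzmann_weight_def by (intro prod_pos) (auto intro: w)
  have "b \<in> Omega R b"
    using assms(3) by (simp add: Omega_def)
  then have Z: "?Z > 0"
    using fin pos by (intro sum_pos) auto
  have "(\<integral>\<^sup>+f. ennreal (?p f) \<partial>count_space UNIV) = (\<Sum>f\<in>Omega R b. ennreal (?p f))"
    by (intro nn_integral_count_space'[OF fin]) auto
  also have "\<dots> = ennreal (\<Sum>f\<in>Omega R b. ?p f)"
    using pos Z by (intro sum_ennreal) (auto intro!: divide_nonneg_pos less_imp_le)
  also have "(\<Sum>f\<in>Omega R b. ?p f) = 1"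
    using Z by (simp add: sum_divide_distrib[symmetric])
  finally show ?thesis
    unfolding boltzmann_def
    by (intro pmf_embed_pmf) (use pos Z in \<open>auto intro!: divide_nonneg_pos less_imp_le\<close>)
qed

end

(* Each boundary E of g = f1 - f2 carries a height function H_E, obtained by integrating the part of
   the increments of g that lies on E. It takes two values differing by d + 1, one on either side of
   E, and g is the sum of the H_E. Exchanging f1 and f2 across E preserves the weight, changes the
   sign of H_E and fixes the other H_F, so distinct boundaries are orthogonal. Hence E g(x)^2 is
   (d + 1)^2 times the expected number of boundaries separating x from 0, and Var f(x) is half of
   E g(x)^2. *)

theory Submission
  imports Defs
begin

section \<open>Graphs\<close>

text \<open>The part of the increments of \<open>g\<close> on a boundary E can be integrated for two
  reasons. Closedness on simplicial loops suffices for exactness, because commuting squares follow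
  from it and words with a common endpoint can then be rearranged into each other. And on a loop
  \<open>g\<close> either stays constant or jumps once by d + 1 and once by -(d + 1); the two jumps
  share the loop, so both or neither lie on E. The tree structure of LSD is used only through the
  functions H_E: each separates the ends of its own edge and of no other, so the distance is the
  number of H_E that differ at two vertices. The normalisation H_E(0) = 0 ties the exchange to the
  boundary condition. The complement of R is connected and contains 0, and \<open>g\<close> vanishes
  there, so H_E does too and the exchanged pair stays in Omega(R, b). The set of boundaries depends
  on the pair. Orthogonality is therefore stated for fixed edge sets E and F, with contribution 0
  from pairs that do not have them as boundaries, and the exchange acts on all pairs at
  once.\<close>

lemma linked_sym: "(u, v) \<in> linked V E \<Longrightarrow> (v, u) \<in> linked V E"
proof -
  have "sym {(u, v). u \<in> V \<and> v \<in> V \<and> {u, v} \<in> E}"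
    by (auto simp: sym_def insert_commute)
  then have "sym (linked V E)"
    unfolding linked_def by (rule sym_rtrancl)
  then show "(u, v) \<in> linked V E \<Longrightarrow> (v, u) \<in> linked V E"
    by (auto simp: sym_def)
qed

lemma linked_refl [simp]: "(u, u) \<in> linked V E"
  by (simp add: linked_def)

lemma linked_trans: "(u, v) \<in> linked V E \<Longrightarrow> (v, t) \<in> linked V E \<Longrightarrow> (u, t) \<in> linked V E"
  unfolding linked_def by (rule rtrancl_trans)

lemma linked_edge: "u \<in> V \<Longrightarrow> v \<in> V \<Longrightarrow> {u, v} \<in> E \<Longrightarrow> (u, v) \<in> linked V E"
  unfolding linked_def by auto

lemma linked_mono: "E \<subseteq> E' \<Longrightarrow> (u, v) \<in> linked V E \<Longrightarrow> (u, v) \<in> linked V E'"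
  unfolding linked_def by (rule rtrancl_mono[THEN subsetD]) auto

lemma linked_invariant:
  assumes "(u, v) \<in> linked V E"
    and "\<And>u v. u \<in> V \<Longrightarrow> v \<in> V \<Longrightarrow> {u, v} \<in> E \<Longrightarrow> F u = F v"
  shows "F u = F v"
  using assms(1) unfolding linked_def
  by (induction rule: rtrancl_induct) (use assms(2) in auto)

lemma component_of_eq_iff:
  assumes "u \<in> V" "v \<in> V"
  shows "component_of V E u = component_of V E v \<longleftrightarrow> (u, v) \<in> linked V E"
proof
  assume "component_of V E u = component_of V E v"
  moreover have "v \<in> component_of V E v"
    using assms by (simp add: component_of_def)
  ultimately have "v \<in> component_of V E u"
    by simp
  then show "(u, v) \<in> linked V E"
    by (simp add: component_of_def)
next
  assume uv: "(u, v) \<in> linked V E"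
  have "(u, t) \<in> linked V E \<longleftrightarrow> (v, t) \<in> linked V E" for t
    using linked_trans[OF uv] linked_trans[OF linked_sym[OF uv]] by blast
  then show "component_of V E u = component_of V E v"
    by (simp add: component_of_def)
qed

text \<open>The maps \<open>\<phi> e\<close> behave like the side functions of the edges of a tree.\<close>

lemma graph_dist_eq_card_cuts:
  fixes G :: "('v, 'e) multigraph" and \<phi> :: "'e \<Rightarrow> 'v \<Rightarrow> 'a"
  assumes cut: "\<And>e u v. e \<in> medges G \<Longrightarrow> mends G e = {u, v} \<Longrightarrow> \<phi> e u \<noteq> \<phi> e v"
    and other: "\<And>e e' u v. e \<in> medges G \<Longrightarrow> mends G e = {u, v} \<Longrightarrow> e' \<in> medges G \<Longrightarrow> e' \<noteq> e
                  \<Longrightarrow> \<phi> e' u = \<phi> e' v"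
    and fin: "finite (medges G)"
    and conn: "(u, v) \<in> (madj G)\<^sup>*"
  shows "graph_dist G u v = card {e \<in> medges G. \<phi> e u \<noteq> \<phi> e v}"
proof -
  \<comment> \<open>The number of cuts between two vertices. Each edge changes the side of one cut
    only, so a walk needs at least this many edges.\<close>
  define N where "N u v = card {e \<in> medges G. \<phi> e u \<noteq> \<phi> e v}" for u v
  have sym: "(v, u) \<in> madj G" if "(u, v) \<in> madj G" for u v
    using that by (auto simp: madj_def insert_commute)
  have N_step: "N u v \<le> N u' v + 1" if "(u, u') \<in> madj G" for u u' v
  proof -
    obtain e where e: "e \<in> medges G" "mends G e = {u, u'}"
      using \<open>(u, u') \<in> madj G\<close> by (auto simp: madj_def)
    have "{e \<in> medges G. \<phi> e u \<noteq> \<phi> e v} \<subseteq> insert e {e \<in> medges G. \<phi> e u' \<noteq> \<phi> e v}"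
      using other[OF e] by auto
    then have "N u v \<le> card (insert e {e \<in> medges G. \<phi> e u' \<noteq> \<phi> e v})"
      unfolding N_def using fin by (intro card_mono) auto
    also have "\<dots> \<le> N u' v + 1"
      unfolding N_def using card_insert_le_m1 fin by (simp add: card_insert_if)
    finally show ?thesis .
  qed
  have lower: "N u v \<le> n" if "(u, v) \<in> madj G ^^ n" for n u v
    using that
  proof (induction n arbitrary: u)
    case 0
    then show ?case by (simp add: N_def)
  next
    case (Suc n)
    then obtain u' where "(u, u') \<in> madj G" "(u', v) \<in> madj G ^^ n"
      by (meson relpow_Suc_D2)
    then show ?case
      using Suc.IH[of u'] N_step[of u u' v] by linarith
  qed
  \<comment> \<open>Take the first passage of the walk through \<open>e\<close>: before it no edge
    has changed the side with respect to \<open>e\<close>, so it starts on the side of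
    \<open>u\<close>.\<close>
  have cross: "\<exists>a a' m. mends G e = {a, a'} \<and> \<phi> e a = \<phi> e u \<and> m < n \<and> (a', v) \<in> madj G ^^ m"
    if "e \<in> medges G" "\<phi> e u \<noteq> \<phi> e v" "(u, v) \<in> madj G ^^ n" for e u v n
    using that
  proof (induction n arbitrary: u)
    case 0
    then show ?case by simp
  next
    case (Suc n)
    then obtain u' where u': "(u, u') \<in> madj G" "(u', v) \<in> madj G ^^ n"
      by (meson relpow_Suc_D2)
    then obtain e' where e': "e' \<in> medges G" "mends G e' = {u, u'}"
      by (auto simp: madj_def)
    show ?case
    proof (cases "e' = e")
      case True
      then show ?thesis using e' u' by blast
    next
      case False
      then have "\<phi> e u' = \<phi> e u"
        using other[OF e', of e] Suc.prems(1) by simp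
      then show ?thesis
        using Suc.IH[of u'] Suc.prems u' by (metis less_SucI)
    qed
  qed
  have upper: "\<exists>m \<le> N u v. (u, v) \<in> madj G ^^ m"
    using conn
  proof (induction rule: converse_rtrancl_induct)
    case base
    show ?case by (rule exI[of _ 0]) simp
  next
    case (step a b)
    then obtain m where m: "m \<le> N b v" "(b, v) \<in> madj G ^^ m"
      by blast
    obtain e where e: "e \<in> medges G" "mends G e = {a, b}"
      using step(1) by (auto simp: madj_def)
    show ?case
    proof (cases "\<phi> e b = \<phi> e v")
      case True
      then have "{e \<in> medges G. \<phi> e a \<noteq> \<phi> e v} = insert e {e \<in> medges G. \<phi> e b \<noteq> \<phi> e v}"
        using other[OF e] cut[OF e] e(1) by (auto, metis)
      then have "N a v = N b v + 1"
        unfolding N_def using fin True by simp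
      moreover have "(a, v) \<in> madj G ^^ Suc m"
        using step(1) m(2) by (meson relpow_Suc_I2)
      ultimately show ?thesis using m(1) by (intro exI[of _ "Suc m"]) simp
    next
      case False
      \<comment> \<open>Here the edge from \<open>a\<close> to \<open>b\<close> leads away from
        \<open>v\<close>. The walk from \<open>b\<close> must come back over \<open>e\<close>, hence
        through \<open>a\<close>, and its remainder from \<open>a\<close> is strictly shorter than
        \<open>m\<close>.\<close>
      from cross[OF e(1) this m(2)] obtain c c' k where c:
        "mends G e = {c, c'}" "\<phi> e c = \<phi> e b" "k < m" "(c', v) \<in> madj G ^^ k"
        by blast
      have "c' = a"
        using cut[OF e] c(1,2) e(2) by (metis doubleton_eq_iff)
      moreover have "N b v \<le> N a v + 1"
        by (rule N_step[OF sym[OF step(1)]])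
      ultimately show ?thesis using c m by (intro exI[of _ k]) simp
    qed
  qed
  then obtain m where m: "m \<le> N u v" "(u, v) \<in> madj G ^^ m"
    by blast
  then have "m = N u v" using lower[OF m(2)] by simp
  then have "graph_dist G u v = N u v"
    unfolding graph_dist_def using m lower by (intro Least_equality) auto
  then show ?thesis by (simp add: N_def)
qed


section \<open>Closed forms on the simplicial lattice\<close>

lemma zero_in_lattice [simp]: "0 \<in> lattice_verts"
  by (auto simp: lattice_verts_def linear_0[OF linear_proj_H] intro!: image_eqI[of _ _ 0])

lemma lattice_verts_add_gvecs: "x \<in> lattice_verts \<Longrightarrow> x + sum_list (map gvec l) \<in> lattice_verts"
proof (induction l arbitrary: x)
  case (Cons i l)
  then show ?case
    using Cons.IH[OF lattice_verts_add_gvec(1)[OF Cons.prems, of i]] by (simp add: add.assoc)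
qed simp

lemma sum_gvec: "(\<Sum>i\<in>UNIV. gvec i) = (0 :: real ^ 'n)"
  by (simp add: gvec_eq sum_subtractf nvec_def[symmetric] sum_constant_scaleR del: sum_constant)

lemma sum_list_gvec_enum:
  assumes "distinct p" "set p = UNIV"
  shows "sum_list (map gvec p) = (0 :: real ^ 'n)"
  using assms sum_gvec by (simp add: sum_list_distinct_conv_sum_set)

text \<open>The endpoint determines the letter counts of a word up to one additive constant common
  to all letters.\<close>

lemma sum_list_gvec_nth:
  "sum_list (map gvec l) $ j = real (count (mset l) j) - real (length l) / real CARD('n)"
  for l :: "'n::finite list"
  by (induction l) (auto simp: gvec_eq axis_def field_simps)

text \<open>The generators sum to 0, so adding a large constant \<open>m\<close> to every integer
  coefficient moves nothing and makes all coefficients nonnegative. Words therefore need no inverse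
  letters.\<close>

lemma lattice_vert_as_gvecs:
  fixes x :: "real ^ 'n"
  assumes "x \<in> lattice_verts"
  shows "\<exists>l. sum_list (map gvec l) = x"
proof -
  have nonneg: "\<exists>l. sum_list (map gvec l) = (\<Sum>i\<in>F. real (k i) *\<^sub>R (gvec i :: real ^ 'n))"
    if "finite F" for F and k :: "'n \<Rightarrow> nat"
    using that
  proof (induction F rule: finite_induct)
    case empty
    show ?case by (rule exI[of _ "[]"]) simp
  next
    case (insert i F)
    then obtain l where "sum_list (map gvec l) = (\<Sum>i\<in>F. real (k i) *\<^sub>R (gvec i :: real ^ 'n))"
      by blast
    then show ?case
      using insert by (intro exI[of _ "replicate (k i) i @ l"])
        (simp add: sum_list_replicate sum_constant_scaleR scaleR_conv_of_real)
  qed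
  obtain z where z: "x = proj_H z" "\<And>i. z $ i \<in> \<int>"
    using assms by (auto simp: lattice_verts_def)
  define m where "m = (\<Sum>i\<in>UNIV. \<bar>\<lfloor>z $ i\<rfloor>\<bar>)"
  have m: "\<lfloor>z $ i\<rfloor> + m \<ge> 0" for i
  proof -
    have "\<bar>\<lfloor>z $ i\<rfloor>\<bar> \<le> m"
      unfolding m_def by (rule member_le_sum) auto
    then show ?thesis by linarith
  qed
  have "x = proj_H (\<Sum>i\<in>UNIV. (z $ i) *\<^sub>R axis i 1)"
    by (simp add: z(1) basis_expansion scalar_mult_eq_scaleR[symmetric])
  also have "\<dots> = (\<Sum>i\<in>UNIV. of_int \<lfloor>z $ i\<rfloor> *\<^sub>R gvec i)"
    using z(2) by (simp add: linear_sum[OF linear_proj_H] linear_cmul[OF linear_proj_H] gvec_def)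
  also have "\<dots> = (\<Sum>i\<in>UNIV. of_int \<lfloor>z $ i\<rfloor> *\<^sub>R gvec i) + of_int m *\<^sub>R (\<Sum>i\<in>UNIV. gvec i)"
    by (simp add: sum_gvec)
  also have "\<dots> = (\<Sum>i\<in>UNIV. real (nat (\<lfloor>z $ i\<rfloor> + m)) *\<^sub>R gvec i)"
    using m by (simp add: scaleR_sum_right sum.distrib[symmetric] scaleR_add_left del: of_nat_nat)
      (simp add: of_nat_nat scaleR_add_left)
  finally show ?thesis
    using nonneg[of UNIV "\<lambda>i. nat (\<lfloor>z $ i\<rfloor> + m)"] by auto
qed

section \<open>Discrete 1-forms, their line integrals and potentials\<close>

primrec path_sum :: "(real ^ 'n::finite \<Rightarrow> real ^ 'n \<Rightarrow> int) \<Rightarrow> real ^ 'n \<Rightarrow> 'n list \<Rightarrow> int" where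
  "path_sum c x [] = 0"
| "path_sum c x (i # l) = c x (x + gvec i) + path_sum c (x + gvec i) l"

text \<open>Simplicial loops play the role of the 2-cells on which closedness is tested.\<close>

definition closed_form :: "(real ^ 'n \<Rightarrow> real ^ 'n \<Rightarrow> int) \<Rightarrow> bool" where
  "closed_form c \<longleftrightarrow> (\<forall>s. simplicial_loop s \<longrightarrow> (\<Sum>k = 1..CARD('n). c (s (k - 1)) (s k)) = 0)"

text \<open>For closed forms the choice of the word is immaterial. The value 0 off the lattice means
  that adding a potential to a height function leaves it \<open>undefined\<close> there.\<close>

definition potential :: "(real ^ 'n \<Rightarrow> real ^ 'n \<Rightarrow> int) \<Rightarrow> real ^ 'n \<Rightarrow> int" where
  "potential c x =
     (if x \<in> lattice_verts then path_sum c 0 (SOME l. sum_list (map gvec l) = x) else 0)"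

lemma path_sum_append:
  "path_sum c x (l @ l') = path_sum c x l + path_sum c (x + sum_list (map gvec l)) l'"
  by (induction l arbitrary: x) (simp_all add: add.assoc)

lemma path_sum_eq_sum:
  "path_sum c x p = (\<Sum>k<length p. c (x + sum_list (map gvec (take k p)))
                                    (x + sum_list (map gvec (take (Suc k) p))))"
  by (induction p arbitrary: x) (simp_all add: sum.lessThan_Suc_shift add.assoc del: sum.lessThan_Suc)

text \<open>A word that uses each generator once spells a simplicial loop, with list positions
  shifted by one against loop indices.\<close>

lemma path_sum_enum:
  fixes c :: "real ^ 'n \<Rightarrow> real ^ 'n \<Rightarrow> int"
  assumes c: "closed_form c" and x: "x \<in> lattice_verts" and p: "distinct p" "set p = UNIV"
  shows "path_sum c x p = 0"
proof -
  have len: "length p = CARD('n)"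
    using p distinct_card by fastforce
  define s where "s k = x + sum_list (map gvec (take k p))" for k
  have "simplicial_loop s"
    unfolding simplicial_loop_def
  proof (intro conjI exI[of _ "\<lambda>k. p ! (k - 1)"] ballI)
    show "s 0 \<in> lattice_verts" "s CARD('n) = s 0"
      using x sum_list_gvec_enum[OF p] by (simp_all add: s_def len)
    have "bij_betw ((!) p) {..<CARD('n)} UNIV"
      using p len by (intro bij_betw_nth) auto
    moreover have "bij_betw (\<lambda>k. k - 1) {1..CARD('n)} {..<CARD('n)}"
      by (rule bij_betwI[where g = Suc]) auto
    ultimately show "bij_betw (\<lambda>k. p ! (k - 1)) {1..CARD('n)} UNIV"
      using bij_betw_trans by (fastforce simp: o_def)
    fix k assume "k \<in> {1..CARD('n)}"
    then obtain j where "k = Suc j" "j < length p"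
      using len by (cases k) auto
    then show "s k = s (k - 1) + gvec (p ! (k - 1))"
      by (simp add: s_def take_Suc_conv_app_nth)
  qed
  then have "(\<Sum>k = 1..CARD('n). c (s (k - 1)) (s k)) = 0"
    using c by (simp add: closed_form_def)
  also have "(\<Sum>k = 1..CARD('n). c (s (k - 1)) (s k)) = (\<Sum>k<CARD('n). c (s k) (s (Suc k)))"
    by (rule sum.reindex_bij_witness[of _ Suc "\<lambda>k. k - 1"]) auto
  finally show ?thesis
    by (simp add: path_sum_eq_sum s_def len)
qed

lemma path_sum_enums:
  assumes "closed_form c" "distinct p" "set p = UNIV" "x \<in> lattice_verts"
  shows "path_sum c x (concat (replicate a p)) = 0"
  using assms
  by (induction a) (simp_all add: path_sum_append path_sum_enum sum_list_gvec_enum)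

text \<open>Compare two simplicial loops from \<open>x\<close> that begin with \<open>i\<close>,
  \<open>j\<close> and with \<open>j\<close>, \<open>i\<close> and continue with the same remaining
  letters: their tails cancel.\<close>

lemma closed_form_square:
  fixes c :: "real ^ 'n \<Rightarrow> real ^ 'n \<Rightarrow> int"
  assumes c: "closed_form c" and x: "x \<in> lattice_verts"
  shows "c x (x + gvec i) + c (x + gvec i) (x + gvec i + gvec j) =
         c x (x + gvec j) + c (x + gvec j) (x + gvec i + gvec j)"
proof (cases "i = j")
  case False
  obtain r where r: "set r = UNIV - {i, j}" "distinct r"
    using finite_distinct_list[of "UNIV - {i, j}"] by auto
  have "path_sum c x ([i, j] @ r) = 0" "path_sum c x ([j, i] @ r) = 0"
    using r False by (intro path_sum_enum[OF c x]; auto)+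
  moreover have "x + gvec j + gvec i = x + gvec i + gvec j"
    by (metis add.assoc add.commute)
  ultimately show ?thesis by simp
qed simp

text \<open>The letter travels to the front by adjacent transpositions, each of which is a
  square.\<close>

lemma path_sum_remove1:
  assumes c: "closed_form c" and x: "x \<in> lattice_verts" and i: "i \<in> set l"
  shows "path_sum c x l = path_sum c x (i # remove1 i l)"
  using x i
proof (induction l arbitrary: x)
  case (Cons j l)
  show ?case
  proof (cases "i = j")
    case False
    then have "path_sum c (x + gvec j) l = path_sum c (x + gvec j) (i # remove1 i l)"
      using Cons by (intro Cons.IH) (auto intro: lattice_verts_add_gvec)
    moreover have "x + gvec j + gvec i = x + gvec i + gvec j"
      by (metis add.assoc add.commute)
    ultimately show ?thesis
      using closed_form_square[OF c Cons.prems(1), of i j] False by simp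
  qed simp
qed simp

lemma path_sum_mset:
  assumes c: "closed_form c" and x: "x \<in> lattice_verts" and "mset l = mset l'"
  shows "path_sum c x l = path_sum c x l'"
  using x assms(3)
proof (induction l arbitrary: x l')
  case (Cons i l)
  then have i: "i \<in> set l'"
    by (metis list.set_intros(1) set_mset_mset)
  have "mset l = mset (remove1 i l')"
    using Cons.prems(2) by (metis add_mset_remove_trivial mset.simps(2) mset_remove1)
  then have "path_sum c (x + gvec i) l = path_sum c (x + gvec i) (remove1 i l')"
    using Cons by (intro Cons.IH) (auto intro: lattice_verts_add_gvec)
  then show ?case
    using path_sum_remove1[OF c Cons.prems(1) i] by simp
qed simp

text \<open>Two words with the same endpoint become permutations of each other after appending
  copies of an enumeration of all generators.\<close>

lemma path_sum_cong_endpoint: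
  fixes c :: "real ^ 'n \<Rightarrow> real ^ 'n \<Rightarrow> int"
  assumes c: "closed_form c" and x: "x \<in> lattice_verts"
    and eq: "sum_list (map gvec l) = (sum_list (map gvec l') :: real ^ 'n)"
  shows "path_sum c x l = path_sum c x l'"
proof -
  obtain p :: "'n list" where p: "set p = UNIV" "distinct p"
    using finite_distinct_list[of "UNIV :: 'n set"] by auto
  have count_p: "count (mset p) j = 1" for j
    using p by (metis UNIV_I distinct_count_atmost_1)
  have count_ps: "count (mset (concat (replicate a p))) j = a" for a j
    by (induction a) (simp_all add: count_p)
  \<comment> \<open>One reference letter is enough: the letter counts of \<open>l\<close> and
    \<open>l'\<close> differ by a constant, so padding each word by the count of \<open>j0\<close>
    in the other equalises the counts of every letter.\<close>
  fix j0 :: 'n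
  define a b where "a = count (mset l') j0" and "b = count (mset l) j0"
  let ?l = "l @ concat (replicate a p)" and ?l' = "l' @ concat (replicate b p)"
  have "mset ?l = mset ?l'"
  proof (rule multiset_eqI)
    fix j
    have "real (count (mset l) j) - real (count (mset l') j) =
          real (length l) / real CARD('n) - real (length l') / real CARD('n)" for j
      using sum_list_gvec_nth[of l j] sum_list_gvec_nth[of l' j] eq by simp
    from this[of j] this[of j0]
    have "real (count (mset l) j + a) = real (count (mset l') j + b)"
      by (simp add: a_def b_def)
    then have "count (mset l) j + a = count (mset l') j + b"
      by (simp only: of_nat_eq_iff)
    then show "count (mset ?l) j = count (mset ?l') j"
      by (simp only: mset_append count_union count_ps)
  qed
  then have "path_sum c x ?l = path_sum c x ?l'"
    by (rule path_sum_mset[OF c x])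
  then show ?thesis
    using x by (simp add: path_sum_append path_sum_enums[OF c p(2,1)] lattice_verts_add_gvecs)
qed

lemma potential_eq_path_sum:
  assumes "closed_form c" "sum_list (map gvec l) = x" 
  shows "potential c x = path_sum c 0 l"
proof -
  have x: "x \<in> lattice_verts"
    using assms(2) lattice_verts_add_gvecs[of 0 l] by simp
  have "sum_list (map gvec (SOME l. sum_list (map gvec l) = x)) = x"
    using assms(2) by (rule someI)
  then show ?thesis
    using x assms path_sum_cong_endpoint[OF assms(1) zero_in_lattice] by (simp add: potential_def)
qed

lemma potential_zero: "closed_form c \<Longrightarrow> potential c 0 = 0"
  using potential_eq_path_sum[of c "[]" 0] by simp

lemma potential_step:
  assumes "closed_form c" "x \<in> lattice_verts"
  shows "potential c (x + gvec i) = potential c x + c x (x + gvec i)"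
proof -
  obtain l where l: "sum_list (map gvec l) = x"
    using assms(2) lattice_vert_as_gvecs by blast
  then show ?thesis
    using potential_eq_path_sum[OF assms(1), of l x]
      potential_eq_path_sum[OF assms(1), of "l @ [i]" "x + gvec i"]
    by (simp add: path_sum_append)
qed

text \<open>Along any word to \<open>x\<close>, \<open>F\<close> accumulates exactly the path sum,
  in particular along the chosen one. This recognises the potentials that belong to an exchanged
  pair.\<close>

lemma potential_unique:
  assumes "F 0 = 0" "\<And>x i. x \<in> lattice_verts \<Longrightarrow> F (x + gvec i) = F x + c x (x + gvec i)"
    and "\<And>x. x \<notin> lattice_verts \<Longrightarrow> F x = 0"
  shows "potential c = F"
proof
  fix x
  have *: "F (x + sum_list (map gvec l)) = F x + path_sum c x l" if "x \<in> lattice_verts" for x l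
    using that
  proof (induction l arbitrary: x)
    case (Cons i l)
    then show ?case
      using Cons.IH[of "x + gvec i"] assms(2)[of x i]
      by (simp add: lattice_verts_add_gvec add.assoc)
  qed simp
  show "potential c x = F x"
  proof (cases "x \<in> lattice_verts")
    case True
    then have "sum_list (map gvec (SOME l. sum_list (map gvec l) = x)) = x"
      by (rule someI_ex[OF lattice_vert_as_gvecs])
    then show ?thesis
      using True *[of 0 "SOME l. sum_list (map gvec l) = x"] assms(1) by (simp add: potential_def)
  qed (simp add: potential_def assms(3))
qed

section \<open>Pairs of height functions\<close>

lemma simplicial_loop_in_lattice:
  fixes s :: "nat \<Rightarrow> real ^ 'n"
  assumes "simplicial_loop s" "k \<le> CARD('n)"
  shows "s k \<in> lattice_verts"
  using assms(2)
proof (induction k)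
  case 0
  then show ?case using assms(1) by (simp add: simplicial_loop_def)
next
  case (Suc k)
  obtain \<xi> where "\<forall>k\<in>{1..CARD('n)}. s k = s (k - 1) + gvec (\<xi> k)"
    using assms(1) by (auto simp: simplicial_loop_def)
  from this[rule_format, of "Suc k"] have "s (Suc k) = s k + gvec (\<xi> (Suc k))"
    using Suc.prems by simp
  then show ?case
    using Suc by (simp add: lattice_verts_add_gvec)
qed

lemma simplicial_loop_edge:
  fixes s :: "nat \<Rightarrow> real ^ 'n"
  assumes "simplicial_loop s" "k \<in> {1..CARD('n)}"
  shows "{s (k - 1), s k} \<in> lattice_edges"
proof -
  have "s (k - 1) \<in> lattice_verts"
    using assms by (intro simplicial_loop_in_lattice) auto
  moreover obtain i where "s k = s (k - 1) + gvec i"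
    using assms by (auto simp: simplicial_loop_def)
  ultimately show ?thesis
    by (auto simp: lattice_edges_def)
qed

text \<open>Each increment is 1 minus either 0 or d + 1, and the d + 1 increments of a loop sum to
  0, so the term d + 1 occurs exactly once.\<close>

lemma height_on_loop:
  fixes s :: "nat \<Rightarrow> real ^ 'n"
  assumes f: "f \<in> height_functions" and s: "simplicial_loop s"
  shows "\<exists>k0\<in>{1..CARD('n)}. \<forall>k\<in>{1..CARD('n)}.
           f (s k) - f (s (k - 1)) = (if k = k0 then 1 - int CARD('n) else 1)"
proof -
  let ?n = "CARD('n)"
  define A where "A = {k \<in> {1..?n}. f (s k) - f (s (k - 1)) = 1 - int ?n}"
  have n: "?n > 0"
    by simp
  have inc: "f (s k) - f (s (k - 1)) = (if k \<in> A then 1 - int ?n else 1)" if "k \<in> {1..?n}" for k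
  proof -
    have "s (k - 1) \<in> lattice_verts"
      using s that by (intro simplicial_loop_in_lattice) auto
    moreover obtain i where "s k = s (k - 1) + gvec i"
      using s \<open>k \<in> {1..?n}\<close> by (auto simp: simplicial_loop_def)
    ultimately have "f (s k) - f (s (k - 1)) \<in> {1, 1 - int ?n}"
      using f by (auto simp: height_functions_def)
    then show ?thesis using that by (auto simp: A_def)
  qed
  have "0 = f (s ?n) - f (s 0)"
    using s by (simp add: simplicial_loop_def)
  also have "\<dots> = (\<Sum>k = 1..?n. f (s k) - f (s (k - 1)))"
    using sum_telescope''[of 0 ?n "\<lambda>k. f (s k)"] by simp
  also have "\<dots> = (\<Sum>k = 1..?n. 1 - (if k \<in> A then int ?n else 0))"
    using inc by (intro sum.cong) auto
  also have "\<dots> = int ?n - int ?n * int (card ({1..?n} \<inter> A))"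
    by (simp add: sum_subtractf sum.If_cases)
  also have "{1..?n} \<inter> A = A"
    by (auto simp: A_def)
  finally have "int ?n * int (card A) = int ?n * 1"
    by simp
  then have "card A = 1"
    using n by (metis mult_cancel_left of_nat_0_less_iff less_irrefl of_nat_eq_1_iff)
  then obtain k0 where "A = {k0}"
    by (auto simp: card_1_singleton_iff)
  then have "k0 \<in> {1..?n}" "\<And>k. k \<in> A \<longleftrightarrow> k = k0"
    unfolding A_def by auto
  then show ?thesis
    using inc by (intro bexI[of _ k0]) auto
qed

text \<open>The differential of \<open>g\<close> cut off to \<open>E\<close>; its potential, defined
  next, is the function H_E.\<close>

definition boundary_form ::
  "(real ^ 'n \<Rightarrow> int) \<Rightarrow> (real ^ 'n) set set \<Rightarrow> real ^ 'n \<Rightarrow> real ^ 'n \<Rightarrow> int" where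
  "boundary_form g E u v = (if {u, v} \<in> E then g v - g u else 0)"

definition boundary_height ::
  "(real ^ 'n \<Rightarrow> int) \<Rightarrow> (real ^ 'n) set set \<Rightarrow> real ^ 'n \<Rightarrow> int" where
  "boundary_height g E = potential (boundary_form g E)"

section \<open>Jump edges, boundaries and their lower and upper ends\<close>

lemma lattice_edge_step: "x \<in> lattice_verts \<Longrightarrow> {x, x + gvec i} \<in> lattice_edges"
  by (auto simp: lattice_edges_def)

lemma lattice_edge_cases:
  assumes "{u, v} \<in> lattice_edges"
  obtains i where "v = u + gvec i" "u \<in> lattice_verts" | i where "u = v + gvec i" "v \<in> lattice_verts"
proof -
  obtain x i where "{u, v} = {x, x + gvec i}" "x \<in> lattice_verts"
    using assms by (auto simp: lattice_edges_def)
  then show ?thesis using that by (metis doubleton_eq_iff)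
qed

lemma Vset_pair: "{u, v} \<in> Vset g \<longleftrightarrow> {u, v} \<in> lattice_edges \<and> g u \<noteq> g v"
  by (auto simp: Vset_def constant_on_def)

lemma Vset_cong:
  assumes "\<And>x i. x \<in> lattice_verts \<Longrightarrow> (g (x + gvec i) = g x) = (h (x + gvec i) = h x)"
  shows "Vset g = Vset h"
proof -
  have "e \<in> Vset g \<longleftrightarrow> e \<in> Vset h" for e
  proof (cases "e \<in> lattice_edges")
    case True
    then obtain x i where "e = {x, x + gvec i}" "x \<in> lattice_verts"
      by (auto simp: lattice_edges_def)
    then show ?thesis using assms[of x i] by (auto simp: Vset_pair)
  qed (auto simp: Vset_def)
  then show ?thesis by blast
qed

lemma boundaries_cong: "Vset g = Vset h \<Longrightarrow> boundaries g = boundaries h"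
  by (simp add: boundaries_def boundary_graph_edges_def)

lemma boundary_subset: "E \<in> boundaries g \<Longrightarrow> E \<subseteq> Vset g"
  by (auto simp: boundaries_def components_of_def component_of_def)

lemma boundary_nonempty: "E \<in> boundaries g \<Longrightarrow> E \<noteq> {}"
  by (auto simp: boundaries_def components_of_def component_of_def)

lemma boundary_eq_component:
  assumes "E \<in> boundaries g" "e \<in> E"
  shows "E = component_of (Vset g) (boundary_graph_edges g) e"
proof -
  obtain e0 where e0: "e0 \<in> Vset g" "E = component_of (Vset g) (boundary_graph_edges g) e0"
    using assms(1) by (auto simp: boundaries_def components_of_def)
  then have "e \<in> Vset g" "(e0, e) \<in> linked (Vset g) (boundary_graph_edges g)"
    using assms(2) by (auto simp: component_of_def)
  then show ?thesis
    using e0 component_of_eq_iff by metis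
qed

lemma boundary_unique: "E \<in> boundaries g \<Longrightarrow> E' \<in> boundaries g \<Longrightarrow> e \<in> E \<Longrightarrow> e \<in> E' \<Longrightarrow> E = E'"
  using boundary_eq_component by metis

lemma Vset_in_boundary: "e \<in> Vset g \<Longrightarrow> \<exists>E\<in>boundaries g. e \<in> E"
  unfolding boundaries_def components_of_def component_of_def by (auto intro!: bexI[of _ e])

lemma minmax_ends:
  assumes "g u < g v"
  shows "xminus g {u, v} = u" "xplus g {u, v} = (v :: real ^ 'n)"
proof -
  show "xminus g {u, v} = u"
    unfolding xminus_def arg_min_on_def
    by (rule arg_minI[of "\<lambda>x. x \<in> {u, v}" u]) (use assms in \<open>auto simp: not_less\<close>)
  show "xplus g {u, v} = v"
    unfolding xplus_def arg_max_on_def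
    by (rule arg_maxI[of "\<lambda>x. x \<in> {u, v}" v]) (use assms in \<open>auto simp: not_less\<close>)
qed

lemma Vset_ends:
  assumes "e \<in> Vset g"
  shows "e = {xminus g e, xplus g e}" "g (xminus g e) < g (xplus g e)"
    "xminus g e \<in> lattice_verts" "xplus g e \<in> lattice_verts"
proof -
  obtain x i where x: "e = {x, x + gvec i}" "x \<in> lattice_verts"
    using assms by (auto simp: Vset_def lattice_edges_def)
  have ne: "g x \<noteq> g (x + gvec i)"
    using assms x by (simp add: Vset_pair)
  have "e = {xminus g e, xplus g e} \<and> g (xminus g e) < g (xplus g e)"
  proof (cases "g x < g (x + gvec i)")
    case True
    then show ?thesis using minmax_ends[of g] x by simp
  next
    case False
    then have "g (x + gvec i) < g x" using ne by simp
    then show ?thesis using minmax_ends[of g "x + gvec i" x] x by (simp add: insert_commute)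
  qed
  then show *: "e = {xminus g e, xplus g e}" "g (xminus g e) < g (xplus g e)"
    by blast+
  have "e \<subseteq> lattice_verts"
    using x lattice_verts_add_gvec by auto
  then show "xminus g e \<in> lattice_verts" "xplus g e \<in> lattice_verts"
    using *(1) by blast+
qed

lemma lattice_linked:
  assumes "x \<in> lattice_verts" "y \<in> lattice_verts"
  shows "(x, y) \<in> linked lattice_verts lattice_edges"
proof -
  have *: "(x, x + sum_list (map gvec l)) \<in> linked lattice_verts lattice_edges"
    if "x \<in> lattice_verts" for x :: "real ^ 'n" and l
    using that
  proof (induction l arbitrary: x)
    case (Cons i l)
    have "(x, x + gvec i) \<in> linked lattice_verts lattice_edges"
      using Cons.prems by (intro linked_edge lattice_edge_step lattice_verts_add_gvec)
    then show ?case
      using Cons.IH[of "x + gvec i"] Cons.prems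
      by (auto simp: lattice_verts_add_gvec add.assoc intro: linked_trans)
  qed simp
  have "(0, z) \<in> linked lattice_verts lattice_edges" if "z \<in> lattice_verts" for z :: "real ^ 'n"
    using *[of 0] lattice_vert_as_gvecs[OF that] by auto
  then show ?thesis
    using assms linked_trans linked_sym by metis
qed

text \<open>Correcting by H_E exchanges the increments of the two functions on the edges of a
  boundary \<open>E\<close> while keeping both values at 0.\<close>

definition swap1 ::
  "(real ^ 'n \<Rightarrow> int) \<Rightarrow> (real ^ 'n \<Rightarrow> int) \<Rightarrow> (real ^ 'n) set set \<Rightarrow> real ^ 'n \<Rightarrow> int" where
  "swap1 f1 g E = (\<lambda>y. f1 y - boundary_height g E y)"

definition swap2 ::
  "(real ^ 'n \<Rightarrow> int) \<Rightarrow> (real ^ 'n \<Rightarrow> int) \<Rightarrow> (real ^ 'n) set set \<Rightarrow> real ^ 'n \<Rightarrow> int" where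
  "swap2 f2 g E = (\<lambda>y. f2 y + boundary_height g E y)"

text \<open>Around a simplicial loop each of the two functions takes exactly one step \<open>-d\<close>, so their
  difference \<open>g\<close> is either constant on the loop or has exactly one step down and one step up.
  Everything about level sets and boundaries follows from this.\<close>

locale height_pair =
  fixes f1 f2 g :: "real ^ 'n \<Rightarrow> int"
  assumes f1: "f1 \<in> height_functions" and f2: "f2 \<in> height_functions"
    and g_eq: "\<And>y. g y = f1 y - f2 y"
begin

lemma loop_steps:
  assumes "simplicial_loop s"
  obtains k1 k2 where "k1 \<in> {1..CARD('n)}" "k2 \<in> {1..CARD('n)}"
    "\<And>k. k \<in> {1..CARD('n)} \<Longrightarrow> g (s k) - g (s (k - 1)) =
       (if k = k2 then int CARD('n) else 0) - (if k = k1 then int CARD('n) else 0)"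
proof -
  obtain k1 where k1: "k1 \<in> {1..CARD('n)}" "\<And>k. k \<in> {1..CARD('n)} \<Longrightarrow>
      f1 (s k) - f1 (s (k - 1)) = (if k = k1 then 1 - int CARD('n) else 1)"
    using height_on_loop[OF f1 assms] by blast
  obtain k2 where k2: "k2 \<in> {1..CARD('n)}" "\<And>k. k \<in> {1..CARD('n)} \<Longrightarrow>
      f2 (s k) - f2 (s (k - 1)) = (if k = k2 then 1 - int CARD('n) else 1)"
    using height_on_loop[OF f2 assms] by blast
  show ?thesis
  proof (rule that[OF k1(1) k2(1)])
    fix k assume "k \<in> {1..CARD('n)}"
    then show "g (s k) - g (s (k - 1)) =
       (if k = k2 then int CARD('n) else 0) - (if k = k1 then int CARD('n) else 0)"
      using k1(2)[of k] k2(2)[of k] by (auto simp: g_eq)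
  qed
qed

text \<open>The two jumps of \<open>g\<close> on a loop have opposite signs, and the loop itself
  makes their edges adjacent in the boundary graph. So \<open>E\<close> contains both, and they
  cancel, or neither.\<close>

lemma boundary_form_closed:
  assumes E: "E \<in> boundaries g"
  shows "closed_form (boundary_form g E)"
  unfolding closed_form_def
proof (intro allI impI)
  fix s :: "nat \<Rightarrow> real ^ 'n" assume s: "simplicial_loop s"
  let ?n = "CARD('n)"
  obtain k1 k2 where k: "k1 \<in> {1..?n}" "k2 \<in> {1..?n}"
    and inc: "\<And>k. k \<in> {1..?n} \<Longrightarrow> g (s k) - g (s (k - 1)) =
       (if k = k2 then int ?n else 0) - (if k = k1 then int ?n else 0)"
    using loop_steps[OF s] by blast
  define e where "e k = {s (k - 1), s k}" for k
  show "(\<Sum>k = 1..?n. boundary_form g E (s (k - 1)) (s k)) = 0"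
  proof (cases "k1 = k2")
    case True
    then have "boundary_form g E (s (k - 1)) (s k) = 0" if "k \<in> {1..?n}" for k
      using inc[OF that] by (simp add: boundary_form_def)
    then show ?thesis by (intro sum.neutral) blast
  next
    case False
    have "s k \<noteq> s (k - 1) \<and> e k \<in> Vset g" if "k \<in> {k1, k2}" for k
      using that k inc[of k] False simplicial_loop_edge[OF s, of k] by (auto simp: e_def Vset_pair)
    then have V: "e k1 \<in> Vset g" "e k2 \<in> Vset g" by auto
    \<comment> \<open>The boundary graph joins only distinct edges, so two positions that traverse
      the same edge are treated apart.\<close>
    have "(e k1, e k2) \<in> linked (Vset g) (boundary_graph_edges g)"
    proof (cases "e k1 = e k2")
      case False
      have "traverses s (e k1)" "traverses s (e k2)"
        using k by (auto simp: traverses_def e_def)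
      then have "{e k1, e k2} \<in> boundary_graph_edges g"
        using False V s unfolding boundary_graph_edges_def by blast
      then show ?thesis by (rule linked_edge[OF V])
    qed simp
    then have same: "e k1 \<in> E \<longleftrightarrow> e k2 \<in> E"
      using boundary_eq_component[OF E] V linked_sym by (metis (no_types, lifting) component_of_def mem_Collect_eq)
    have "(\<Sum>k = 1..?n. boundary_form g E (s (k - 1)) (s k)) =
        (\<Sum>k = 1..?n. (if k = k2 then (if e k2 \<in> E then int ?n else 0) else 0) -
           (if k = k1 then (if e k2 \<in> E then int ?n else 0) else 0))"
      by (rule sum.cong) (use inc same False in \<open>auto simp: boundary_form_def e_def\<close>)
    also have "\<dots> = 0"
      using k by (simp add: sum_subtractf)
    finally show ?thesis .
  qed
qed

section \<open>The height function of a boundary and its two sides\<close>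

lemma boundary_height_zero: "E \<in> boundaries g \<Longrightarrow> boundary_height g E 0 = 0"
  unfolding boundary_height_def by (rule potential_zero[OF boundary_form_closed])

lemma boundary_height_outside: "x \<notin> lattice_verts \<Longrightarrow> boundary_height g E x = 0"
  by (simp add: boundary_height_def potential_def)

lemma boundary_height_step:
  assumes "E \<in> boundaries g" "x \<in> lattice_verts"
  shows "boundary_height g E (x + gvec i) = boundary_height g E x +
           (if {x, x + gvec i} \<in> E then g (x + gvec i) - g x else 0)"
  unfolding boundary_height_def
  using potential_step[OF boundary_form_closed[OF assms(1)] assms(2)] by (simp add: boundary_form_def)

lemma boundary_height_edge:
  assumes "E \<in> boundaries g" "{u, v} \<in> lattice_edges"
  shows "boundary_height g E v - boundary_height g E u = (if {u, v} \<in> E then g v - g u else 0)"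
  using assms(2)
proof (cases rule: lattice_edge_cases)
  case (1 i)
  then show ?thesis using boundary_height_step[OF assms(1), of u i] by simp
next
  case (2 i)
  then show ?thesis using boundary_height_step[OF assms(1), of v i] by (simp add: insert_commute)
qed

text \<open>Both increments lie in {1, -d}, so where they differ they differ by d + 1.\<close>

lemma g_edge:
  assumes "e \<in> Vset g"
  shows "g (xplus g e) - g (xminus g e) = int CARD('n)"
proof -
  have *: "g (x + gvec i) - g x \<in> {0, int CARD('n), - int CARD('n)}" if "x \<in> lattice_verts" for x i
  proof -
    have "f1 (x + gvec i) - f1 x \<in> {1, 1 - int CARD('n)}" "f2 (x + gvec i) - f2 x \<in> {1, 1 - int CARD('n)}"
      using f1 f2 that unfolding height_functions_def by blast+
    then show ?thesis by (auto simp: g_eq)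
  qed
  note ends = Vset_ends[OF assms]
  have "{xminus g e, xplus g e} \<in> lattice_edges"
    using assms ends(1) by (auto simp: Vset_def)
  then show ?thesis
  proof (cases rule: lattice_edge_cases)
    case (1 i)
    then show ?thesis using *[of "xminus g e" i] ends(2) by auto
  next
    case (2 i)
    then show ?thesis using *[of "xplus g e" i] ends(2) by auto
  qed
qed

lemma boundary_height_ends:
  assumes "E \<in> boundaries g" "e \<in> E"
  shows "boundary_height g E (xplus g e) = boundary_height g E (xminus g e) + int CARD('n)"
proof -
  have e: "e \<in> Vset g" using assms boundary_subset by blast
  have "{xminus g e, xplus g e} = e" using Vset_ends[OF e] by simp
  moreover have "e \<in> lattice_edges" using e by (simp add: Vset_def)
  ultimately show ?thesis
    using boundary_height_edge[OF assms(1), of "xminus g e" "xplus g e"] g_edge[OF e] assms(2) by simp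
qed

lemma boundary_height_cong_linked:
  assumes "E \<in> boundaries g" "(u, v) \<in> linked V (lattice_edges - E)"
  shows "boundary_height g E u = boundary_height g E v"
  using assms(2)
proof (rule linked_invariant)
  fix u v assume "{u, v} \<in> lattice_edges - E"
  then show "boundary_height g E u = boundary_height g E v"
    using boundary_height_edge[OF assms(1), of u v] by simp
qed

text \<open>Adjacent boundary edges cut a simplicial loop into two arcs on which \<open>g\<close> is constant; one arc
  joins the lower ends and the other one the upper ends.\<close>

lemma adjacent_ends_linked:
  assumes "{e, e'} \<in> boundary_graph_edges g" 
  shows "(xminus g e, xminus g e') \<in> linked lattice_verts (lattice_edges - Vset g)"
    and "(xplus g e, xplus g e') \<in> linked lattice_verts (lattice_edges - Vset g)"
proof -
  let ?n = "CARD('n)" and ?L = "linked lattice_verts (lattice_edges - Vset g)"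
  obtain s where s: "simplicial_loop s" "traverses s e" "traverses s e'"
    and V: "e \<in> Vset g" "e' \<in> Vset g" "e \<noteq> e'"
    using assms by (auto simp: boundary_graph_edges_def doubleton_eq_iff)
  obtain k1 k2 where k: "k1 \<in> {1..?n}" "k2 \<in> {1..?n}"
    and inc: "\<And>k. k \<in> {1..?n} \<Longrightarrow> g (s k) - g (s (k - 1)) =
       (if k = k2 then int ?n else 0) - (if k = k1 then int ?n else 0)"
    using loop_steps[OF s(1)] by blast
  define c where "c k = {s (k - 1), s k}" for k
  obtain j j' where j: "e = c j" "j \<in> {1..?n}" "e' = c j'" "j' \<in> {1..?n}"
    using s by (auto simp: traverses_def c_def)
  \<comment> \<open>Coinciding positions \<open>k1 = k2\<close> would cancel and leave
    \<open>g\<close> constant on the loop, so the two given edges sit exactly at \<open>k1\<close>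
    and \<open>k2\<close>.\<close>
  have jk: "k1 \<noteq> k2 \<and> i \<in> {k1, k2}" if "i \<in> {1..?n}" "c i \<in> Vset g" for i
    using that inc[of i] by (auto simp: c_def Vset_pair split: if_splits)
  have ne: "k1 \<noteq> k2" and jj: "j = k1 \<and> j' = k2 \<or> j = k2 \<and> j' = k1"
    using jk[of j] jk[of j'] j V by auto
  have arc: "(s a, s b) \<in> ?L" if "a \<le> b" "b \<le> ?n" "\<And>k. a < k \<Longrightarrow> k \<le> b \<Longrightarrow> k \<noteq> k1 \<and> k \<noteq> k2" for a b
    using that
  proof (induction b rule: dec_induct)
    case (step b)
    have "g (s (Suc b)) = g (s b)"
      using step inc[of "Suc b"] step.prems(2)[of "Suc b"] by auto
    then have "{s b, s (Suc b)} \<in> lattice_edges - Vset g"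
      using simplicial_loop_edge[OF s(1), of "Suc b"] step by (auto simp: Vset_pair)
    then have "(s b, s (Suc b)) \<in> ?L"
      using step by (intro linked_edge simplicial_loop_in_lattice[OF s(1)]) auto
    then show ?case
      using step by (auto intro: linked_trans)
  qed simp
  \<comment> \<open>The complementary arc runs through the base point of the loop and is split at
    \<open>s CARD('n) = s 0\<close>.\<close>
  have wrap: "(s a, s b) \<in> ?L"
    if "a \<le> ?n" "b \<le> ?n" "\<And>k. a < k \<Longrightarrow> k \<le> ?n \<Longrightarrow> k \<noteq> k1 \<and> k \<noteq> k2"
       "\<And>k. k \<le> b \<Longrightarrow> k \<noteq> k1 \<and> k \<noteq> k2" for a b
  proof -
    have "(s a, s ?n) \<in> ?L" "(s 0, s b) \<in> ?L"
      using that k by (auto intro!: arc)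
    moreover have "s ?n = s 0" using s(1) by (simp add: simplicial_loop_def)
    ultimately show ?thesis by (auto intro: linked_trans)
  qed
  have "g (s k1) < g (s (k1 - 1))" "g (s (k2 - 1)) < g (s k2)"
    using inc[of k1] inc[of k2] ne k by auto
  then have ends: "xminus g (c k1) = s k1" "xplus g (c k1) = s (k1 - 1)"
     "xminus g (c k2) = s (k2 - 1)" "xplus g (c k2) = s k2"
    using minmax_ends[of g "s k1" "s (k1 - 1)"] minmax_ends[of g "s (k2 - 1)" "s k2"]
    by (simp_all add: c_def insert_commute)
  have "(s k1, s (k2 - 1)) \<in> ?L \<and> (s k2, s (k1 - 1)) \<in> ?L"
  proof (cases "k1 < k2")
    case True
    have "(s k1, s (k2 - 1)) \<in> ?L"
      by (rule arc) (use True k in auto)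
    moreover have "(s k2, s (k1 - 1)) \<in> ?L"
      by (rule wrap) (use True k in auto)
    ultimately show ?thesis by blast
  next
    case False
    then have "k2 < k1" using ne by simp
    have "(s k2, s (k1 - 1)) \<in> ?L"
      by (rule arc) (use \<open>k2 < k1\<close> k in auto)
    moreover have "(s k1, s (k2 - 1)) \<in> ?L"
      by (rule wrap) (use \<open>k2 < k1\<close> k in auto)
    ultimately show ?thesis by blast
  qed
  then have "(xminus g (c k1), xminus g (c k2)) \<in> ?L" "(xplus g (c k2), xplus g (c k1)) \<in> ?L"
    by (simp_all add: ends)
  then show "(xminus g e, xminus g e') \<in> ?L" "(xplus g e, xplus g e') \<in> ?L"
    using jj j linked_sym by auto
qed

lemma boundary_ends_linked:
  assumes E: "E \<in> boundaries g" "e \<in> E" "e' \<in> E"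
  shows "(xminus g e, xminus g e') \<in> linked lattice_verts (lattice_edges - Vset g)"
    and "(xplus g e, xplus g e') \<in> linked lattice_verts (lattice_edges - Vset g)"
proof -
  have "(e, e') \<in> linked (Vset g) (boundary_graph_edges g)"
    using boundary_eq_component[OF E(1,2)] E(3) by (auto simp: component_of_def)
  then have "(xminus g e, xminus g e') \<in> linked lattice_verts (lattice_edges - Vset g) \<and>
    (xplus g e, xplus g e') \<in> linked lattice_verts (lattice_edges - Vset g)"
    unfolding linked_def[of "Vset g"]
  proof (induction rule: rtrancl_induct)
    case (step e' e'')
    then have "{e', e''} \<in> boundary_graph_edges g"
      by simp
    then show ?case
      using adjacent_ends_linked step.IH linked_trans by metis
  qed simp
  then show "(xminus g e, xminus g e') \<in> linked lattice_verts (lattice_edges - Vset g)"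
    and "(xplus g e, xplus g e') \<in> linked lattice_verts (lattice_edges - Vset g)"
    by blast+
qed

text \<open>Follow a walk from \<open>x\<close> to an end of \<open>e\<close> until it first meets
  \<open>E\<close>. The end of \<open>E\<close> reached there is joined to the corresponding end of
  \<open>e\<close> inside a level set, hence without using \<open>E\<close>.\<close>

lemma linked_to_boundary:
  assumes E: "E \<in> boundaries g" "e \<in> E" and x: "x \<in> lattice_verts"
  shows "(x, xminus g e) \<in> linked lattice_verts (lattice_edges - E) \<or>
         (x, xplus g e) \<in> linked lattice_verts (lattice_edges - E)" (is "?P x")
proof -
  have ends: "?P (xminus g e')" "?P (xplus g e')" if "e' \<in> E" for e'
    using boundary_ends_linked[OF E(1) that E(2)] boundary_subset[OF E(1)]
    by (meson Diff_mono linked_mono order_refl)+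
  have "e \<in> Vset g" using E boundary_subset by blast
  then have "(x, xminus g e) \<in> linked lattice_verts lattice_edges"
    using x lattice_linked Vset_ends by blast
  then show ?thesis
    unfolding linked_def[of lattice_verts lattice_edges]
  proof (induction rule: converse_rtrancl_induct)
    case base
    show ?case using ends(1)[OF E(2)] .
  next
    case (step x y)
    show ?case
    proof (cases "{x, y} \<in> E")
      case True
      then have "x \<in> {xminus g {x, y}, xplus g {x, y}}"
        using Vset_ends(1)[of "{x, y}" g] boundary_subset[OF E(1)] by blast
      then show ?thesis using ends[OF True] by auto
    next
      case False
      then have "(x, y) \<in> linked lattice_verts (lattice_edges - E)"
        using step by (intro linked_edge) auto
      then show ?thesis using step.IH linked_trans by metis
    qed
  qed
qed

text \<open>Every vertex is joined off \<open>E\<close> to one of the two ends of \<open>e\<close>.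
  H_E is constant along such connections and differs by d + 1 between the ends, so its value names
  the side.\<close>

lemma separates_iff_boundary_height:
  assumes E: "E \<in> boundaries g" and x: "x \<in> lattice_verts" and y: "y \<in> lattice_verts"
  shows "separates E x y \<longleftrightarrow> boundary_height g E x \<noteq> boundary_height g E y" (is ?A)
    and "boundary_height g E x - boundary_height g E y \<in> {0, int CARD('n), - int CARD('n)}" (is ?B)
proof -
  let ?H = "boundary_height g E" and ?L = "linked lattice_verts (lattice_edges - E)"
  obtain e where e: "e \<in> E" using boundary_nonempty[OF E] by blast
  note cong = boundary_height_cong_linked[OF E]
  have side: "\<exists>t\<in>{xminus g e, xplus g e}. (z, t) \<in> ?L \<and> ?H z = ?H t" if "z \<in> lattice_verts" for z
    using linked_to_boundary[OF E e that] cong by blast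
  obtain t where t: "t \<in> {xminus g e, xplus g e}" "(x, t) \<in> ?L" "?H x = ?H t"
    using side[OF x] by blast
  obtain t' where t': "t' \<in> {xminus g e, xplus g e}" "(y, t') \<in> ?L" "?H y = ?H t'"
    using side[OF y] by blast
  note ends = boundary_height_ends[OF E e]
  show ?B using t t' ends by auto
  have "?H x = ?H y \<Longrightarrow> t = t'"
    using t t' ends by auto
  then have "?H x = ?H y \<Longrightarrow> (x, y) \<in> ?L"
    using t(2) t'(2) linked_sym linked_trans by metis
  then show ?A
    using cong component_of_eq_iff[OF x y] unfolding separates_def by blast
qed

section \<open>Boundaries as cuts of the level set decomposition\<close>

lemma boundary_height_level_set:
  assumes "E \<in> boundaries g" "u \<in> lattice_verts" "v \<in> lattice_verts" "level_set_of g u = level_set_of g v"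
  shows "boundary_height g E u = boundary_height g E v"
proof -
  have "(u, v) \<in> linked lattice_verts (lattice_edges - Vset g)"
    using assms component_of_eq_iff unfolding level_set_of_def by metis
  then have "(u, v) \<in> linked lattice_verts (lattice_edges - E)"
    using boundary_subset[OF assms(1)] by (meson Diff_mono linked_mono order_refl)
  then show ?thesis by (rule boundary_height_cong_linked[OF assms(1)])
qed

text \<open>All lower ends of \<open>E\<close> lie in one level set and all upper ends in another
  one; as level sets are disjoint, no further level set can contain either family.\<close>

lemma LSD_ends:
  assumes E: "E \<in> boundaries g" "e \<in> E"
  shows "mends (LSD g) E = {level_set_of g (xminus g e), level_set_of g (xplus g e)}"
proof -
  have V: "e' \<in> E \<Longrightarrow> e' \<in> Vset g" for e' using E(1) boundary_subset by blast
  have mem: "u \<in> level_set_of g u" if "u \<in> lattice_verts" for u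
    using that by (simp add: level_set_of_def component_of_def)
  have uniq: "A = level_set_of g u" if A: "A \<in> level_sets g" "u \<in> A" for A u
  proof -
    obtain v where v: "v \<in> lattice_verts" "A = level_set_of g v"
      using A(1) unfolding level_sets_def components_of_def level_set_of_def by blast
    then have "u \<in> lattice_verts" "(v, u) \<in> linked lattice_verts (lattice_edges - Vset g)"
      using A(2) by (auto simp: level_set_of_def component_of_def)
    then show ?thesis
      using v component_of_eq_iff unfolding level_set_of_def by metis
  qed
  have sub: "xminus g ` E \<subseteq> level_set_of g (xminus g e)" "xplus g ` E \<subseteq> level_set_of g (xplus g e)"
    by (intro image_subsetI;
        simp add: level_set_of_def component_of_def boundary_ends_linked[OF E] Vset_ends(3,4)[OF V])+
  have "level_set_of g u \<in> level_sets g" if "u \<in> lattice_verts" for u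
    using that by (auto simp: level_sets_def components_of_def level_set_of_def)
  then show ?thesis
    using sub uniq E(2) Vset_ends(3,4)[OF V[OF E(2)]] unfolding LSD_def by (auto 0 4)
qed

lemma LSD_dist_eq_card:
  assumes fin: "finite (boundaries g)" and x: "x \<in> lattice_verts" and y: "y \<in> lattice_verts"
  shows "LSD_dist g x y = card {E \<in> boundaries g. separates E x y}"
proof -
  \<comment> \<open>H_E is constant on level sets, so it descends to the vertices of LSD through any
    representative.\<close>
  define \<phi> where "\<phi> E A = boundary_height g E (SOME u. u \<in> lattice_verts \<and> level_set_of g u = A)" for E A
  have \<phi>: "\<phi> E (level_set_of g u) = boundary_height g E u" if "E \<in> boundaries g" "u \<in> lattice_verts" for E u
  proof -
    let ?v = "SOME v. v \<in> lattice_verts \<and> level_set_of g v = level_set_of g u"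
    have "?v \<in> lattice_verts \<and> level_set_of g ?v = level_set_of g u"
      by (rule someI[of _ u]) (use that in simp)
    then show ?thesis
      unfolding \<phi>_def using boundary_height_level_set that by blast
  qed
  have ends: "\<exists>e\<in>E. e \<in> Vset g \<and> {A, B} = {level_set_of g (xminus g e), level_set_of g (xplus g e)}"
    if "E \<in> boundaries g" "mends (LSD g) E = {A, B}" for E A B
    using that LSD_ends boundary_nonempty boundary_subset by (metis all_not_in_conv subsetD)
  have edges: "medges (LSD g) = boundaries g"
    by (simp add: LSD_def)
  have "graph_dist (LSD g) (level_set_of g x) (level_set_of g y) =
        card {E \<in> medges (LSD g). \<phi> E (level_set_of g x) \<noteq> \<phi> E (level_set_of g y)}"
  proof (rule graph_dist_eq_card_cuts)
    show "finite (medges (LSD g))" using fin by (simp add: edges)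
  next
    fix E A B assume E: "E \<in> medges (LSD g)" "mends (LSD g) E = {A, B}"
    then have E': "E \<in> boundaries g" by (simp add: edges)
    from ends[OF E' E(2)] obtain e where e: "e \<in> E" "e \<in> Vset g"
      "{A, B} = {level_set_of g (xminus g e), level_set_of g (xplus g e)}" by blast
    have "\<phi> E (level_set_of g (xminus g e)) \<noteq> \<phi> E (level_set_of g (xplus g e))"
      using boundary_height_ends[OF E' e(1)] Vset_ends(3,4)[OF e(2)] E' by (simp add: \<phi>)
    then show "\<phi> E A \<noteq> \<phi> E B" using e(3) by (metis doubleton_eq_iff)
  next
    fix E F A B assume E: "E \<in> medges (LSD g)" "mends (LSD g) E = {A, B}"
      and F: "F \<in> medges (LSD g)" "F \<noteq> E"
    then have E': "E \<in> boundaries g" "F \<in> boundaries g" by (simp_all add: edges)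
    from ends[OF E'(1) E(2)] obtain e where e: "e \<in> E" "e \<in> Vset g"
      "{A, B} = {level_set_of g (xminus g e), level_set_of g (xplus g e)}" by blast
    have "e \<notin> F" using boundary_unique E' e F by blast
    moreover have "e = {xminus g e, xplus g e}" "e \<in> lattice_edges"
      using Vset_ends(1)[OF e(2)] e(2) by (simp_all add: Vset_def)
    ultimately have "boundary_height g F (xplus g e) = boundary_height g F (xminus g e)"
      using boundary_height_edge[OF E'(2), of "xminus g e" "xplus g e"] by simp
    then have "\<phi> F (level_set_of g (xminus g e)) = \<phi> F (level_set_of g (xplus g e))"
      using Vset_ends(3,4)[OF e(2)] E' by (simp add: \<phi>)
    then show "\<phi> F A = \<phi> F B" using e(3) by (metis doubleton_eq_iff)
  next
    have step: "(level_set_of g u, level_set_of g v) \<in> (madj (LSD g))\<^sup>*"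
      if uv: "u \<in> lattice_verts" "v \<in> lattice_verts" "{u, v} \<in> lattice_edges" for u v
    proof (cases "{u, v} \<in> Vset g")
      case False
      then have "level_set_of g u = level_set_of g v"
        using uv component_of_eq_iff linked_edge unfolding level_set_of_def by (metis DiffI)
      then show ?thesis by simp
    next
      case True
      then obtain E where E: "E \<in> boundaries g" "{u, v} \<in> E"
        using Vset_in_boundary by blast
      have "{u, v} = {xminus g {u, v}, xplus g {u, v}}" using Vset_ends(1)[OF True] .
      then have "mends (LSD g) E = {level_set_of g u, level_set_of g v}"
        unfolding LSD_ends[OF E] by (metis doubleton_eq_iff)
      moreover have "level_set_of g u \<in> mverts (LSD g)" "level_set_of g v \<in> mverts (LSD g)"
        using uv by (auto simp: LSD_def level_sets_def components_of_def level_set_of_def)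
      ultimately show ?thesis
        using E by (auto simp: madj_def edges)
    qed
    show "(level_set_of g x, level_set_of g y) \<in> (madj (LSD g))\<^sup>*"
      using lattice_linked[OF x y] unfolding linked_def
      by (induction rule: rtrancl_induct) (auto intro: rtrancl_trans step)
  qed
  also have "{E \<in> medges (LSD g). \<phi> E (level_set_of g x) \<noteq> \<phi> E (level_set_of g y)} =
     {E \<in> boundaries g. separates E x y}"
    using x y by (auto simp: edges \<phi> separates_iff_boundary_height)
  finally show ?thesis by (simp add: LSD_dist_def)
qed

text \<open>Every jump edge lies in exactly one boundary, so on each edge a single summand carries
  the whole increment of \<open>g\<close>.\<close>

lemma g_eq_sum_boundary_height:
  assumes fin: "finite (boundaries g)" and "g 0 = 0" and x: "x \<in> lattice_verts"
  shows "g x = (\<Sum>E\<in>boundaries g. boundary_height g E x)"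
proof -
  let ?D = "\<lambda>x. g x - (\<Sum>E\<in>boundaries g. boundary_height g E x)"
  have "?D 0 = ?D x"
    using lattice_linked[OF zero_in_lattice x]
  proof (rule linked_invariant)
    fix u v :: "real ^ 'n" assume uv: "{u, v} \<in> lattice_edges"
    have "(\<Sum>E\<in>boundaries g. boundary_height g E v) - (\<Sum>E\<in>boundaries g. boundary_height g E u) =
      (\<Sum>E\<in>boundaries g. if {u, v} \<in> E then g v - g u else 0)"
      by (simp add: sum_subtractf[symmetric] boundary_height_edge uv)
    also have "\<dots> = g v - g u"
    proof (cases "{u, v} \<in> Vset g")
      case True
      then obtain E where E: "E \<in> boundaries g" "{u, v} \<in> E"
        using Vset_in_boundary by blast
      then have "(\<Sum>F\<in>boundaries g. if {u, v} \<in> F then g v - g u else 0) =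
                 (\<Sum>F\<in>boundaries g. if F = E then g v - g u else 0)"
        using boundary_unique by (intro sum.cong) auto
      then show ?thesis using E fin by simp
    next
      case False
      then have "g v - g u = 0" using uv by (simp add: Vset_pair)
      then show ?thesis by (simp only: if_cancel sum.neutral_const)
    qed
    finally show "?D u = ?D v" by simp
  qed
  then show ?thesis
    using assms(2) by (simp add: boundary_height_zero)
qed

section \<open>Exchanging two height functions across a boundary\<close>

lemma swap_step:
  assumes "E \<in> boundaries g" "x \<in> lattice_verts"
  shows "swap1 f1 g E (x + gvec i) - swap1 f1 g E x =
      (if {x, x + gvec i} \<in> E then f2 (x + gvec i) - f2 x else f1 (x + gvec i) - f1 x)"
    and "swap2 f2 g E (x + gvec i) - swap2 f2 g E x =
      (if {x, x + gvec i} \<in> E then f1 (x + gvec i) - f1 x else f2 (x + gvec i) - f2 x)"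
  using boundary_height_step[OF assms, of i] by (auto simp: swap1_def swap2_def g_eq)

lemma swap_height_functions:
  assumes E: "E \<in> boundaries g"
  shows "swap1 f1 g E \<in> height_functions" "swap2 f2 g E \<in> height_functions"
proof -
  have ext: "f1 \<in> extensional lattice_verts" "f2 \<in> extensional lattice_verts"
    and zero: "int CARD('n) dvd f1 0" "int CARD('n) dvd f2 0"
    and inc: "\<And>x i. x \<in> lattice_verts \<Longrightarrow> f1 (x + gvec i) - f1 x \<in> {1, 1 - int CARD('n)}"
      "\<And>x i. x \<in> lattice_verts \<Longrightarrow> f2 (x + gvec i) - f2 x \<in> {1, 1 - int CARD('n)}"
    using f1 f2 by (auto simp: height_functions_def)
  have "swap1 f1 g E \<in> extensional lattice_verts" "swap2 f2 g E \<in> extensional lattice_verts"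
    using ext by (auto simp: extensional_def swap1_def swap2_def boundary_height_outside)
  moreover have "swap1 f1 g E 0 = f1 0" "swap2 f2 g E 0 = f2 0"
    using E by (simp_all add: swap1_def swap2_def boundary_height_zero)
  moreover have "swap1 f1 g E (x + gvec i) - swap1 f1 g E x \<in> {1, 1 - int CARD('n)}"
    "swap2 f2 g E (x + gvec i) - swap2 f2 g E x \<in> {1, 1 - int CARD('n)}" if "x \<in> lattice_verts" for x i
    unfolding swap_step[OF E that] using inc[OF that, of i] by (cases "{x, x + gvec i} \<in> E"; simp)+
  ultimately show "swap1 f1 g E \<in> height_functions" "swap2 f2 g E \<in> height_functions"
    using zero unfolding height_functions_def by auto
qed

lemma swap_diff: "swap1 f1 g E y - swap2 f2 g E y = g y - 2 * boundary_height g E y"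
  by (simp add: swap1_def swap2_def g_eq)

lemma swap_diff_step:
  assumes "E \<in> boundaries g" "x \<in> lattice_verts"
  shows "(swap1 f1 g E (x + gvec i) - swap2 f2 g E (x + gvec i)) - (swap1 f1 g E x - swap2 f2 g E x) =
    (if {x, x + gvec i} \<in> E then - (g (x + gvec i) - g x) else g (x + gvec i) - g x)"
  unfolding swap_diff using boundary_height_step[OF assms, of i] by simp

text \<open>The exchange only reverses some jumps of \<open>g\<close>, so the jump edges stay the
  same, and boundaries depend on nothing else.\<close>

lemma boundaries_swap:
  assumes "E \<in> boundaries g"
  shows "boundaries (\<lambda>y. swap1 f1 g E y - swap2 f2 g E y) = boundaries g"
proof (intro boundaries_cong Vset_cong)
  fix x i assume "x \<in> (lattice_verts :: (real ^ 'n) set)"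
  from swap_diff_step[OF assms this, of i]
  show "(swap1 f1 g E (x + gvec i) - swap2 f2 g E (x + gvec i) = swap1 f1 g E x - swap2 f2 g E x) = (g (x + gvec i) = g x)"
    by (auto split: if_splits)
qed

text \<open>Jumps are reversed on \<open>E\<close> alone, and a boundary other than \<open>E\<close>
  shares no edge with it.\<close>

lemma boundary_height_swap:
  assumes E: "E \<in> boundaries g" and F: "F \<in> boundaries g"
  shows "boundary_height (\<lambda>y. swap1 f1 g E y - swap2 f2 g E y) F =
    (\<lambda>x. if F = E then - boundary_height g F x else boundary_height g F x)"
  unfolding boundary_height_def[of "\<lambda>y. swap1 f1 g E y - swap2 f2 g E y"]
proof (rule potential_unique)
  fix x i assume x: "x \<in> (lattice_verts :: (real ^ 'n) set)"
  have "{x, x + gvec i} \<in> F \<Longrightarrow> {x, x + gvec i} \<in> E \<longleftrightarrow> F = E"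
    using boundary_unique[OF E F] by blast
  then show "(if F = E then - boundary_height g F (x + gvec i) else boundary_height g F (x + gvec i)) =
    (if F = E then - boundary_height g F x else boundary_height g F x) +
    boundary_form (\<lambda>y. swap1 f1 g E y - swap2 f2 g E y) F x (x + gvec i)"
    using boundary_height_step[OF F x, of i] swap_diff_step[OF E x, of i]
    unfolding boundary_form_def by auto
qed (use F in \<open>auto simp: boundary_height_zero boundary_height_outside\<close>)

lemma tiling_swap:
  assumes "E \<in> boundaries g"
  shows "e \<in> tiling (swap1 f1 g E) \<longleftrightarrow> (if e \<in> E then e \<in> tiling f2 else e \<in> tiling f1)"
    and "e \<in> tiling (swap2 f2 g E) \<longleftrightarrow> (if e \<in> E then e \<in> tiling f1 else e \<in> tiling f2)"
  unfolding tiling_def using swap_step[OF assms] by (auto; metis)+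

end

section \<open>Variance of the heights\<close>

lemma variance_pair_pmf:
  fixes X :: "'a \<Rightarrow> real"
  assumes fin: "finite (set_pmf M)"
  shows "measure_pmf.variance (pair_pmf M M) (\<lambda>(a, b). X a) =
    1 / 2 * measure_pmf.expectation (pair_pmf M M) (\<lambda>(a, b). (X a - X b)\<^sup>2)"
proof -
  let ?A = "set_pmf M" and ?p = "pmf M"
  have ex: "measure_pmf.expectation (pair_pmf M M) F = (\<Sum>a\<in>?A. \<Sum>b\<in>?A. ?p a * ?p b * F (a, b))"
    for F :: "'a \<times> 'a \<Rightarrow> real"
  proof -
    have "measure_pmf.expectation (pair_pmf M M) F = (\<Sum>c\<in>?A \<times> ?A. pmf (pair_pmf M M) c *\<^sub>R F c)"
      by (rule integral_measure_pmf) (use fin in auto)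
    also have "\<dots> = (\<Sum>(a, b)\<in>?A \<times> ?A. ?p a * ?p b * F (a, b))"
      by (rule sum.cong) (auto simp: pmf_pair)
    finally show ?thesis by (simp add: sum.cartesian_product)
  qed
  have one: "(\<Sum>a\<in>?A. ?p a) = 1"
    by (rule sum_pmf_eq_1[OF fin]) simp
  have fst: "measure_pmf.expectation (pair_pmf M M) (\<lambda>(a, b). Y a) = (\<Sum>a\<in>?A. ?p a * Y a)"
    for Y :: "'a \<Rightarrow> real"
  proof -
    have "measure_pmf.expectation (pair_pmf M M) (\<lambda>(a, b). Y a) =
        (\<Sum>a\<in>?A. \<Sum>b\<in>?A. (?p a * Y a) * ?p b)"
      unfolding ex by (intro sum.cong refl) simp
    then show ?thesis
      by (simp only: sum_distrib_left[symmetric] one mult_1_right)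
  qed
  define m where "m = (\<Sum>a\<in>?A. ?p a * X a)"
  \<comment> \<open>Centring makes the mixed term of the square a product of two zero means; the two
    remaining terms are each the variance.\<close>
  define Y where "Y a = X a - m" for a
  have Y0: "(\<Sum>a\<in>?A. ?p a * Y a) = 0"
    by (simp add: Y_def right_diff_distrib sum_subtractf sum_distrib_right[symmetric] one m_def)
  have "measure_pmf.variance (pair_pmf M M) (\<lambda>(a, b). X a) = 
      measure_pmf.expectation (pair_pmf M M) (\<lambda>(a, b). (Y a)\<^sup>2)"
    unfolding fst[of X] m_def[symmetric] Y_def by (simp add: case_prod_unfold)
  also have "\<dots> = (\<Sum>a\<in>?A. ?p a * (Y a)\<^sup>2)" (is "_ = ?v")
    by (rule fst)
  finally have var: "measure_pmf.variance (pair_pmf M M) (\<lambda>(a, b). X a) = ?v" .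
  have "measure_pmf.expectation (pair_pmf M M) (\<lambda>(a, b). (X a - X b)\<^sup>2) =
    (\<Sum>a\<in>?A. \<Sum>b\<in>?A. ?p b * (?p a * (Y a)\<^sup>2) + ?p a * (?p b * (Y b)\<^sup>2)
        - 2 * (?p a * Y a) * (?p b * Y b))"
    unfolding ex by (intro sum.cong refl) (simp add: Y_def power2_eq_square algebra_simps)
  also have "\<dots> = (\<Sum>a\<in>?A. (\<Sum>b\<in>?A. ?p b) * (?p a * (Y a)\<^sup>2) + ?p a * ?v
        - 2 * (?p a * Y a) * (\<Sum>b\<in>?A. ?p b * Y b))"
    by (simp only: sum.distrib sum_subtractf sum_distrib_left sum_distrib_right)
  also have "\<dots> = ?v + (\<Sum>a\<in>?A. ?p a) * ?v"
    unfolding Y0 one by (simp add: sum.distrib sum_distrib_right[symmetric] one)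
  finally show ?thesis using var one by simp
qed

section \<open>Boundary values and weights under the exchange\<close>

lemma finite_incident_edges:
  fixes R :: "(real ^ 'n) set"
  assumes "finite R"
  shows "finite (incident_edges R)"
proof -
  have "incident_edges R \<subseteq> (\<lambda>(x, i). {x, x + gvec i}) ` (R \<times> UNIV) \<union>
      (\<lambda>(x, i). {x - gvec i, x}) ` (R \<times> UNIV)"
  proof
    fix e assume "e \<in> incident_edges R"
    then obtain x i where e: "e = {x, x + gvec i}" "x \<in> R \<or> x + gvec i \<in> R"
      by (auto simp: incident_edges_def lattice_edges_def)
    from e(2) show "e \<in> (\<lambda>(x, i). {x, x + gvec i}) ` (R \<times> UNIV) \<union>
      (\<lambda>(x, i). {x - gvec i, x}) ` (R \<times> UNIV)"
    proof
      assume "x \<in> R"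
      then show ?thesis using e(1) by auto
    next
      assume "x + gvec i \<in> R"
      then show ?thesis
        using e(1) by (intro UnI2 image_eqI[of _ _ "(x + gvec i, i)"]) auto
    qed
  qed
  then show ?thesis
    by (rule finite_subset) (simp add: assms)
qed

context height_pair
begin

text \<open>Off \<open>R\<close> both functions agree with \<open>b\<close>, so every jump edge
  touches \<open>R\<close>.\<close>

lemma finite_boundaries:
  assumes R: "finite R" and \<Omega>: "f1 \<in> Omega R b" "f2 \<in> Omega R b"
  shows "finite (boundaries g)"
proof -
  have "Vset g \<subseteq> incident_edges R"
  proof
    fix e assume e: "e \<in> Vset g"
    have "g u = 0" if "u \<in> lattice_verts - R" for u
      using that \<Omega> by (simp add: Omega_def g_eq)
    then have "u \<in> R \<or> v \<in> R" if "e = {u, v}" "u \<in> lattice_verts" "v \<in> lattice_verts" "g u \<noteq> g v" for u v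
      using that by (metis DiffI)
    then have "xminus g e \<in> R \<or> xplus g e \<in> R"
      using Vset_ends[OF e] by (metis less_irrefl)
    then have "e \<inter> R \<noteq> {}"
      using Vset_ends(1)[OF e] by blast
    then show "e \<in> incident_edges R"
      using e by (simp add: incident_edges_def Vset_def)
  qed
  then have "finite (Vset g)"
    using finite_incident_edges[OF R] finite_subset by blast
  then show ?thesis
    by (simp add: boundaries_def components_of_def)
qed

text \<open>No jump occurs inside the complement of \<open>R\<close>, which is connected and
  contains 0, so H_E keeps its value 0 throughout. This is what keeps the exchange within the given
  boundary condition.\<close>

lemma boundary_height_off_region:
  assumes R: "region R" "0 \<notin> R" and \<Omega>: "f1 \<in> Omega R b" "f2 \<in> Omega R b"
    and E: "E \<in> boundaries g" and y: "y \<in> lattice_verts - R"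
  shows "boundary_height g E y = 0"
proof -
  have "(0, y) \<in> linked (lattice_verts - R) lattice_edges"
    using R y by (simp add: region_def graph_connected_def)
  then have "boundary_height g E 0 = boundary_height g E y"
  proof (rule linked_invariant)
    fix u v :: "real ^ 'n" assume uv: "u \<in> lattice_verts - R" "v \<in> lattice_verts - R" "{u, v} \<in> lattice_edges"
    then have "g u = 0" "g v = 0"
      using \<Omega> by (simp_all add: Omega_def g_eq)
    then show "boundary_height g E u = boundary_height g E v"
      using boundary_height_edge[OF E uv(3)] by (simp split: if_splits)
  qed
  then show ?thesis using boundary_height_zero[OF E] by simp
qed

lemma swap_in_Omega:
  assumes R: "region R" "0 \<notin> R" and \<Omega>: "f1 \<in> Omega R b" "f2 \<in> Omega R b" and E: "E \<in> boundaries g"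
  shows "swap1 f1 g E \<in> Omega R b" "swap2 f2 g E \<in> Omega R b"
  using swap_height_functions[OF E] boundary_height_off_region[OF R \<Omega> E] \<Omega>
  by (auto simp: Omega_def swap1_def swap2_def)

text \<open>Written over all incident edges with default factor 1, each edge contributes one factor
  per function; on \<open>E\<close> these two factors trade places, elsewhere they stay.\<close>

lemma boltzmann_weight_swap:
  assumes R: "finite R" and E: "E \<in> boundaries g"
  shows "boltzmann_weight R w (swap1 f1 g E) * boltzmann_weight R w (swap2 f2 g E) =
    boltzmann_weight R w f1 * boltzmann_weight R w f2"
proof -
  have W: "boltzmann_weight R w f = (\<Prod>e\<in>incident_edges R. if e \<in> tiling f then w e else 1)" for f
    unfolding boltzmann_weight_def
    using prod.inter_restrict[OF finite_incident_edges[OF R], of w "tiling f"] by (simp add: Int_commute)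
  show ?thesis
    unfolding W prod.distrib[symmetric] tiling_swap[OF E] by (rule prod.cong) auto
qed

lemma sum_square_boundary_height:
  assumes fin: "finite (boundaries g)" and x: "x \<in> lattice_verts"
  shows "(\<Sum>E\<in>boundaries g. (boundary_height g E x)\<^sup>2) =
    (int CARD('n))\<^sup>2 * int (card {E \<in> boundaries g. separates E x 0})"
proof -
  have "(boundary_height g E x)\<^sup>2 = (if separates E x 0 then (int CARD('n))\<^sup>2 else 0)"
    if E: "E \<in> boundaries g" for E
    using separates_iff_boundary_height[OF E x zero_in_lattice] boundary_height_zero[OF E] by auto
  then have "(\<Sum>E\<in>boundaries g. (boundary_height g E x)\<^sup>2) =
      (\<Sum>E\<in>boundaries g. if separates E x 0 then (int CARD('n))\<^sup>2 else 0)"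
    by (rule sum.cong[OF refl])
  also have "\<dots> = (int CARD('n))\<^sup>2 * int (card (boundaries g \<inter> {E. separates E x 0}))"
    using fin by (simp add: sum.If_cases)
  also have "boundaries g \<inter> {E. separates E x 0} = {E \<in> boundaries g. separates E x 0}"
    by blast
  finally show ?thesis .
qed

end

lemma separates_commute: "separates E x y \<longleftrightarrow> separates E y x"
  by (auto simp: separates_def)

text \<open>Swapping across \<open>E\<close> is a weight preserving involution that changes the sign of the
  contribution of \<open>E\<close> only, so the contributions of distinct boundaries are orthogonal.\<close>

lemma sum_square_difference:
  fixes R :: "(real ^ 'n) set" and b :: "real ^ 'n \<Rightarrow> int" and x :: "real ^ 'n"
    and w :: "(real ^ 'n) set \<Rightarrow> real"
  assumes R: "region R" "0 \<notin> R" and x: "x \<in> lattice_verts"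
  defines "Q \<equiv> Omega R b \<times> Omega R b"
    and "W \<equiv> (\<lambda>(f1, f2). boltzmann_weight R w f1 * boltzmann_weight R w f2)"
  shows "(\<Sum>(f1, f2)\<in>Q. W (f1, f2) * (real_of_int (f1 x) - real_of_int (f2 x))\<^sup>2) =
    (\<Sum>(f1, f2)\<in>Q. W (f1, f2) * ((real CARD('n))\<^sup>2 *
        real (card {E \<in> boundaries (\<lambda>y. f1 y - f2 y). separates E x 0})))"
proof -
  define D where "D p = (\<lambda>y. fst p y - snd p y)" for p :: "(real ^ 'n \<Rightarrow> int) \<times> (real ^ 'n \<Rightarrow> int)"
  define B where "B p = boundaries (D p)" for p
  \<comment> \<open>Extension by 0 lets the finite union \<open>\<E>\<close> of all boundary sets
    serve as index set for every pair.\<close>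
  define a where "a p E = (if E \<in> B p then real_of_int (boundary_height (D p) E x) else 0)" for p E
  have finR: "finite R" using R by (simp add: region_def)
  have finQ: "finite Q"
    unfolding Q_def using finite_Omega[OF R] by simp
  have pair: "height_pair (fst p) (snd p) (D p)" if "p \<in> Q" for p
    using that by unfold_locales (auto simp: Q_def Omega_def D_def)
  have \<Omega>: "fst p \<in> Omega R b" "snd p \<in> Omega R b" if "p \<in> Q" for p
    using that by (auto simp: Q_def)
  have finB: "finite (B p)" if "p \<in> Q" for p
    unfolding B_def by (rule height_pair.finite_boundaries[OF pair[OF that] finR \<Omega>[OF that]])
  define \<E> where "\<E> = (\<Union>p\<in>Q. B p)"
  have fin\<E>: "finite \<E>" and B\<E>: "p \<in> Q \<Longrightarrow> B p \<subseteq> \<E>" for p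
    using finQ finB by (auto simp: \<E>_def)
  have D0: "D p 0 = 0" if "p \<in> Q" for p
    using \<Omega>[OF that] R(2) by (simp add: Omega_def D_def)
  have a_sum: "(\<Sum>E\<in>\<E>. h (a p E)) = (\<Sum>E\<in>B p. h (real_of_int (boundary_height (D p) E x)))"
    if "p \<in> Q" "h 0 = 0" for p and h :: "real \<Rightarrow> real"
    using fin\<E> B\<E>[OF that(1)] that(2)
    by (intro sum.mono_neutral_cong_right) (auto simp: a_def)
  have D_eq: "real_of_int (D p x) = (\<Sum>E\<in>\<E>. a p E)" if "p \<in> Q" for p
    using a_sum[OF that, of "\<lambda>t. t"]
      height_pair.g_eq_sum_boundary_height[OF pair[OF that] finB[OF that, unfolded B_def] D0[OF that] x]
    by (simp add: B_def)
  have a_sq: "(\<Sum>E\<in>\<E>. (a p E)\<^sup>2) = (real CARD('n))\<^sup>2 * real (card {E \<in> B p. separates E x 0})"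
    if "p \<in> Q" for p
  proof -
    have "(\<Sum>E\<in>\<E>. (a p E)\<^sup>2) = real_of_int (\<Sum>E\<in>B p. (boundary_height (D p) E x)\<^sup>2)"
      using a_sum[OF that, of "\<lambda>t. t\<^sup>2"] by simp
    then show ?thesis
      using height_pair.sum_square_boundary_height[OF pair[OF that] finB[OF that, unfolded B_def] x]
      by (simp add: B_def)
  qed
  have orth: "(\<Sum>p\<in>Q. W p * (a p E * a p F)) = 0" if "E \<noteq> F" for E F
  proof -
    \<comment> \<open>Being the identity on pairs without boundary \<open>E\<close> makes
      \<open>\<sigma>\<close> an involution of all of \<open>Q\<close>; on those pairs the
      contribution of \<open>E\<close> is 0, so the change of sign holds there as well.\<close>
    define \<sigma> where "\<sigma> p = (if E \<in> B p then (swap1 (fst p) (D p) E, swap2 (snd p) (D p) E) else p)" for p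
    have D\<sigma>: "D (\<sigma> p) = (\<lambda>y. swap1 (fst p) (D p) E y - swap2 (snd p) (D p) E y)" if "E \<in> B p" for p
      using that by (simp add: \<sigma>_def D_def)
    have B\<sigma>: "B (\<sigma> p) = B p" if "p \<in> Q" for p
    proof (cases "E \<in> B p")
      case True
      then show ?thesis
        using height_pair.boundaries_swap[OF pair[OF that]] D\<sigma> by (simp add: B_def)
    qed (simp add: \<sigma>_def)
    have H\<sigma>: "boundary_height (D (\<sigma> p)) F' =
        (\<lambda>y. if F' = E then - boundary_height (D p) F' y else boundary_height (D p) F' y)"
      if "p \<in> Q" "E \<in> B p" "F' \<in> B p" for p F'
      using height_pair.boundary_height_swap[OF pair[OF that(1)]] that D\<sigma>[OF that(2)] by (simp add: B_def)
    have \<sigma>Q: "\<sigma> p \<in> Q" if "p \<in> Q" for p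
      using height_pair.swap_in_Omega[OF pair[OF that] R \<Omega>[OF that]] that
      by (simp add: \<sigma>_def Q_def B_def)
    have \<sigma>\<sigma>: "\<sigma> (\<sigma> p) = p" if "p \<in> Q" for p
    proof (cases "E \<in> B p")
      case True
      \<comment> \<open>The first exchange negates H_E, so the second correction cancels the
        first.\<close>
      have "\<sigma> (\<sigma> p) = (swap1 (fst (\<sigma> p)) (D (\<sigma> p)) E, swap2 (snd (\<sigma> p)) (D (\<sigma> p)) E)"
        using True B\<sigma>[OF that] \<sigma>_def[of "\<sigma> p"] by simp
      also have "\<dots> = p"
        unfolding swap1_def swap2_def H\<sigma>[OF that True True]
        using True by (simp add: \<sigma>_def swap1_def swap2_def)
      finally show ?thesis .
    qed (simp add: \<sigma>_def)
    have flip: "W (\<sigma> p) * (a (\<sigma> p) E * a (\<sigma> p) F) = - (W p * (a p E * a p F))" if "p \<in> Q" for p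
    proof (cases "E \<in> B p")
      case True
      then have "W (\<sigma> p) = W p"
        using height_pair.boltzmann_weight_swap[OF pair[OF that] finR]
        by (simp add: W_def \<sigma>_def B_def case_prod_unfold)
      then show ?thesis
        using H\<sigma>[OF that True] True \<open>E \<noteq> F\<close> by (simp add: a_def B\<sigma>[OF that])
    qed (simp add: a_def B\<sigma>[OF that])
    have "(\<Sum>p\<in>Q. W p * (a p E * a p F)) = (\<Sum>p\<in>Q. - (W p * (a p E * a p F)))"
      by (rule sum.reindex_bij_witness[of _ \<sigma> \<sigma>]) (simp_all add: \<sigma>Q \<sigma>\<sigma> flip)
    then show ?thesis by (simp add: sum_negf)
  qed
  have "(\<Sum>p\<in>Q. W p * (real_of_int (D p x))\<^sup>2) = (\<Sum>p\<in>Q. \<Sum>E\<in>\<E>. \<Sum>F\<in>\<E>. W p * (a p E * a p F))"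
    by (rule sum.cong[OF refl])
      (simp only: D_eq power2_eq_square sum_product, simp only: sum_distrib_left)
  also have "\<dots> = (\<Sum>E\<in>\<E>. \<Sum>p\<in>Q. \<Sum>F\<in>\<E>. W p * (a p E * a p F))"
    by (rule sum.swap)
  also have "\<dots> = (\<Sum>E\<in>\<E>. \<Sum>F\<in>\<E>. \<Sum>p\<in>Q. W p * (a p E * a p F))"
    by (rule sum.cong[OF refl sum.swap])
  also have "\<dots> = (\<Sum>E\<in>\<E>. \<Sum>F\<in>\<E>. if F = E then \<Sum>p\<in>Q. W p * (a p E)\<^sup>2 else 0)"
    by (intro sum.cong refl) (use orth in \<open>auto simp: power2_eq_square\<close>)
  also have "\<dots> = (\<Sum>E\<in>\<E>. \<Sum>p\<in>Q. W p * (a p E)\<^sup>2)"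
    using fin\<E> by simp
  also have "\<dots> = (\<Sum>p\<in>Q. W p * (\<Sum>E\<in>\<E>. (a p E)\<^sup>2))"
    unfolding sum_distrib_left by (rule sum.swap)
  also have "\<dots> = (\<Sum>p\<in>Q. W p * ((real CARD('n))\<^sup>2 * real (card {E \<in> B p. separates E x 0})))"
    by (rule sum.cong[OF refl]) (simp add: a_sq)
  finally show ?thesis
    by (simp add: B_def D_def case_prod_unfold)
qed

theorem theorem5p1:
  fixes d :: nat and R :: "(real ^ 'n) set" and b :: "real ^ 'n \<Rightarrow> int"
    and w :: "(real ^ 'n) set \<Rightarrow> real" and x :: "real ^ 'n"
  assumes "d \<ge> 2" and "CARD('n) = d + 1"
    and "region R" and "0 \<notin> R"
    and "b \<in> height_functions"
    and "\<And>e. e \<in> incident_edges R \<Longrightarrow> w e > 0"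
    and "x \<in> lattice_verts"
  shows "measure_pmf.variance (boltzmann_pair R b w) (\<lambda>(f1, f2). real_of_int (f1 x)) =
           1 / 2 * (real d + 1)\<^sup>2 *
           measure_pmf.expectation (boltzmann_pair R b w) (\<lambda>(f1, f2). real (LSD_dist (\<lambda>y. f1 y - f2 y) 0 x)) \<and>
         measure_pmf.variance (boltzmann_pair R b w) (\<lambda>(f1, f2). real_of_int (f1 x)) =
           1 / 2 * (real d + 1)\<^sup>2 *
           measure_pmf.expectation (boltzmann_pair R b w)
             (\<lambda>(f1, f2). real (card {E \<in> boundaries (\<lambda>y. f1 y - f2 y). separates E x 0}))"
proof -
  let ?M = "boltzmann R b w" and ?\<Omega> = "Omega R b" and ?W = "boltzmann_weight R w"
  let ?Z = "\<Sum>h\<in>?\<Omega>. ?W h"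
  let ?N = "\<lambda>f1 f2 :: real ^ 'n \<Rightarrow> int. real (card {E \<in> boundaries (\<lambda>y. f1 y - f2 y). separates E x 0})"
  have fin: "finite ?\<Omega>"
    using assms(3,4) by (rule finite_Omega)
  have pmf: "pmf ?M f = (if f \<in> ?\<Omega> then ?W f / ?Z else 0)" for f
    using assms(3-6) by (rule pmf_boltzmann)
  have supp: "set_pmf ?M \<subseteq> ?\<Omega>"
    by (auto simp: set_pmf_eq pmf split: if_splits)
  \<comment> \<open>The support is finite, so both expectations are finite sums over the common
    denominator \<open>?Z\<^sup>2\<close>, and an identity between unnormalised weighted sums is
    enough.\<close>
  have ex: "measure_pmf.expectation (boltzmann_pair R b w) F =
      (\<Sum>(f1, f2)\<in>?\<Omega> \<times> ?\<Omega>. (?W f1 * ?W f2) * F (f1, f2)) / ?Z\<^sup>2" for F :: "_ \<Rightarrow> real"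
  proof -
    have "measure_pmf.expectation (boltzmann_pair R b w) F =
        (\<Sum>p\<in>?\<Omega> \<times> ?\<Omega>. pmf (pair_pmf ?M ?M) p *\<^sub>R F p)"
      unfolding boltzmann_pair_def by (rule integral_measure_pmf) (use fin supp in auto)
    also have "\<dots> = (\<Sum>(f1, f2)\<in>?\<Omega> \<times> ?\<Omega>. (?W f1 * ?W f2) * F (f1, f2) / ?Z\<^sup>2)"
      by (rule sum.cong) (auto simp: pmf_pair pmf power2_eq_square)
    finally show ?thesis
      by (simp add: sum_divide_distrib case_prod_unfold)
  qed
  have "measure_pmf.variance (boltzmann_pair R b w) (\<lambda>(f1, f2). real_of_int (f1 x)) =
      1 / 2 * measure_pmf.expectation (boltzmann_pair R b w)
        (\<lambda>(f1, f2). (real_of_int (f1 x) - real_of_int (f2 x))\<^sup>2)"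
    unfolding boltzmann_pair_def using finite_subset[OF supp fin] by (rule variance_pair_pmf)
  also have "\<dots> = 1 / 2 * measure_pmf.expectation (boltzmann_pair R b w)
        (\<lambda>(f1, f2). (real CARD('n))\<^sup>2 * ?N f1 f2)"
    unfolding ex using sum_square_difference[OF assms(3,4,7), where b = b and w = w] by simp
  also have "\<dots> = 1 / 2 * (real d + 1)\<^sup>2 *
      measure_pmf.expectation (boltzmann_pair R b w) (\<lambda>(f1, f2). ?N f1 f2)"
    unfolding ex by (simp add: assms(2) sum_distrib_left case_prod_unfold algebra_simps)
  finally have var: "measure_pmf.variance (boltzmann_pair R b w) (\<lambda>(f1, f2). real_of_int (f1 x)) =
      1 / 2 * (real d + 1)\<^sup>2 * measure_pmf.expectation (boltzmann_pair R b w) (\<lambda>(f1, f2). ?N f1 f2)" .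
  \<comment> \<open>The distance formula relies on finitely many boundaries, hence on the common
    boundary condition; the pairs that carry mass all satisfy it.\<close>
  have "real (LSD_dist (\<lambda>y. f1 y - f2 y) 0 x) = ?N f1 f2" if "f1 \<in> ?\<Omega>" "f2 \<in> ?\<Omega>" for f1 f2
  proof -
    interpret height_pair f1 f2 "\<lambda>y. f1 y - f2 y"
      using that by unfold_locales (auto simp: Omega_def)
    show ?thesis
      using finite_boundaries[OF _ that] assms(3,7) LSD_dist_eq_card
      by (simp add: region_def separates_commute[of _ x 0])
  qed
  then have "measure_pmf.expectation (boltzmann_pair R b w) (\<lambda>(f1, f2). real (LSD_dist (\<lambda>y. f1 y - f2 y) 0 x)) =
      measure_pmf.expectation (boltzmann_pair R b w) (\<lambda>(f1, f2). ?N f1 f2)"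
    unfolding ex by (intro arg_cong2[of _ _ _ _ "(/)"] sum.cong) auto
  then show ?thesis using var by simp
qed

end
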